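(* Let $G^\bullet$ be a Gerstenhaber algebra over a field $k$ of characteristic $0$. The set $qBV(G^\bullet)$ of quasi-BV structures on $G^\bullet$ is a torsor (for addition of operators) under the space $$H^0(\mathrm{Tot}\,C^{\cdot\cdot}_{HCH}(G^\bullet,G^\bullet))=\mathrm{Ker}(d_H^{00})\cap\mathrm{Ker}(d_{CH}^{00})=\Omega^{1,\mathrm{cl}}(G^\bullet):=\mathrm{Ker}\{d:\Omega^1(G^\bullet)\to\Omega^2(G^\bullet)\}.$$ For $G^\bullet=\Lambda^\bullet_A(T)$, the Schouten–Nijenhuis algebra of a Lie algebroid $T$ over a commutative $k$-algebra $A$, the $\Omega^{1,\mathrm{cl}}(G^\bullet)$-torsor $qBV(G^\bullet)$ is identified with the $\Omega^{1,\mathrm{cl}}(T)$-torsor $BV(T)$.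
   Context: For a homogeneous element $x\in G^i$ write $\tilde x=i$; for a homogeneous multilinear map $f$ from $G^\bullet$ to $G^\bullet$ let $\tilde f$ be its degree, so that $f(x_1,\ldots,x_n)$ has degree $\tilde f+\sum\tilde x_p$. A Gerstenhaber algebra is a $\mathbb{Z}$-graded (graded-)commutative associative $k$-algebra $G^\bullet$ with a bilinear bracket $[\,,]:G^i\otimes G^j\to G^{i+j-1}$ such that for homogeneous $x,y,z$: $[x,y]=-(-1)^{(\tilde x-1)(\tilde y-1)}[y,x]$; $[x,[y,z]]=[[x,y],z]+(-1)^{(\tilde x-1)(\tilde y-1)}[y,[x,z]]$; $[x,yz]=[x,y]z+(-1)^{\tilde y(\tilde x-1)}y[x,z]$. A quasi-BV structure on $G^\bullet$ is a $k$-linear map $\Delta:G^\bullet\to G^\bullet$ of degree $-1$ such that for homogeneous $x,y$: $\Delta(xy)-\Delta(x)y-(-1)^{\tilde x}x\Delta(y)=(-1)^{\tilde x}[x,y]$ and $\Delta^2(xy)=\Delta^2(x)y+x\Delta^2(y)$, where $\Delta^2=\Delta\circ\Delta$. The Hochschild–Chevalley bicomplex $C^{ij}_{HCH}(G^\bullet,G^\bullet)$, $i\ge 0$, $j\in\{0,1\}$, has terms $C^{n0}_{HCH}=\mathrm{Hom}(\Lambda^{n+1}(G^\bullet[1]),G^\bullet[1])$ and $C^{n1}_{HCH}=\mathrm{Hom}(\Lambda^n(G^\bullet[1])\otimes(G^\bullet[1])^{\otimes 2},G^\bullet[1])$, with horizontal Chevalley differentials $d_{CH}$ and vertical Hochschild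 differentials $d_H$; $\mathrm{Tot}$ is its associated simple complex. The differentials leaving the corner $C^{00}_{HCH}=\mathrm{Hom}(G^\bullet,G^\bullet)$, the only ones entering into $H^0$, are $$d_H^{00}f(x,y)=(-1)^{\tilde x(\tilde f+1)+\tilde f}xf(y)+(-1)^{\tilde f+\tilde x+1}f(xy)+(-1)^{\tilde f+\tilde x}f(x)y\in C^{01}_{HCH},$$ $$d_{CH}^{00}f(x,y)=(-1)^{(\tilde x-1)\tilde f}[x,f(y)]+[f(x),y]-f([x,y])\in C^{10}_{HCH}.$$ $\Omega^1(G^\bullet)$ is the space of degree $-1$ derivations of the graded algebra $G^\bullet$, i.e. $k$-linear $f:G^\bullet\to G^\bullet$ of degree $-1$ with $f(xy)=(-1)^{\tilde x\tilde f}xf(y)+f(x)y$. $\Omega^2(G^\bullet)$ is the space of bilinear maps $f:G^\bullet\times G^\bullet\to G^\bullet$ of degree $-2$ with $f(x,y)=-(-1)^{(\tilde x-1)(\tilde y-1)}f(y,x)$ and $f(x,yz)=(-1)^{\tilde y(\tilde f+\tilde x)}yf(x,z)+f(x,y)z$. The map $d:\Omega^1(G^\bullet)\to\Omega^2(G^\bullet)$ is induced by $d_{CH}^{00}$: $df(x,y)=(-1)^{\tilde x-1}[x,f(y)]+[f(x),y]-f([x,y])$. A Lie algebroid over $A$ is a Lie algebra $T$ that is also an $A$-module and acts, as a Lie algebra, on $A$ by derivations $a\mapsto\tau(a)$, with $(a\tau)(b)=a(\tau(b))$ and $[\tau,a\nu]=a[\tau,\nu]+\tau(a)\nu$ for $a,b\in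 A$, $\tau,\nu\in T$. The Schouten–Nijenhuis bracket is the unique bracket making the exterior algebra $\Lambda^\bullet_A(T)$ a Gerstenhaber algebra, extending the given bracket on $T$ and with $[\tau,a]=\tau(a)$. $BV(T)$ is the set of BV structures on $T$: $k$-linear operators $c:T\to A$ such that $c(a\tau)=ac(\tau)+\tau(a)$ and $c([\tau,\nu])=\tau(c(\nu))-\nu(c(\tau))$. $\Omega^{1,\mathrm{cl}}(T)$ is the space of $\omega\in\mathrm{Hom}_A(T,A)$ with $\omega([\tau,\nu])-\tau(\omega(\nu))+\nu(\omega(\tau))=0$ for all $\tau,\nu\in T$; it acts on $BV(T)$ by addition. *)

theory Defs
  imports Complex_Main "HOL-Library.FuncSet" "HOL-Library.Function_Algebras" "HOL-Library.Poly_Mapping"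
begin

section \<open>Graded algebras and Gerstenhaber algebras\<close>

text \<open>\<open>ksgn i x\<close> is $(-1)^i x$; the ambient ring need not have a unit.\<close>

definition ksgn :: "int \<Rightarrow> 'g::ab_group_add \<Rightarrow> 'g"
  where "ksgn i x = (if even i then x else - x)"

definition bilinear_op ::
  "('k::field \<Rightarrow> 'g::ab_group_add \<Rightarrow> 'g) \<Rightarrow> ('g \<Rightarrow> 'g \<Rightarrow> 'g) \<Rightarrow> bool"
  where "bilinear_op s f \<longleftrightarrow>
    (\<forall>x. Vector_Spaces.linear s s (f x)) \<and> (\<forall>y. Vector_Spaces.linear s s (\<lambda>x. f x y))"

definition is_decomposition :: "(int \<Rightarrow> 'g::ab_group_add set) \<Rightarrow> 'g \<Rightarrow> (int \<Rightarrow> 'g) \<Rightarrow> bool"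
  where "is_decomposition gr x c \<longleftrightarrow>
    (\<forall>i. c i \<in> gr i) \<and> finite {i. c i \<noteq> 0} \<and> x = (\<Sum>i | c i \<noteq> 0. c i)"

text \<open>The homogeneous component of degree \<open>i\<close> of \<open>x\<close>.\<close>

definition hcomp :: "(int \<Rightarrow> 'g::ab_group_add set) \<Rightarrow> 'g \<Rightarrow> int \<Rightarrow> 'g"
  where "hcomp gr x = (THE c. is_decomposition gr x c)"

locale Gerstenhaber_algebra = vector_space s
  for s :: "'k::field_char_0 \<Rightarrow> 'g::ring \<Rightarrow> 'g" +
  fixes gr :: "int \<Rightarrow> 'g set"
    and br :: "'g \<Rightarrow> 'g \<Rightarrow> 'g"
  assumes mult_bilinear: "bilinear_op s (*)"
    and gr_subspace: "subspace (gr i)"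
    and gr_decomposition: "\<exists>!c. is_decomposition gr x c"
    and gr_mult: "x \<in> gr i \<Longrightarrow> y \<in> gr j \<Longrightarrow> x * y \<in> gr (i + j)"
    and graded_commute: "x \<in> gr i \<Longrightarrow> y \<in> gr j \<Longrightarrow> x * y = ksgn (i * j) (y * x)"
    and br_bilinear: "bilinear_op s br"
    and gr_br: "x \<in> gr i \<Longrightarrow> y \<in> gr j \<Longrightarrow> br x y \<in> gr (i + j - 1)"
    and br_skew: "x \<in> gr i \<Longrightarrow> y \<in> gr j \<Longrightarrow> br x y = - ksgn ((i - 1) * (j - 1)) (br y x)"
    and br_Jacobi: "x \<in> gr i \<Longrightarrow> y \<in> gr j \<Longrightarrow> z \<in> gr l \<Longrightarrow>
      br x (br y z) = br (br x y) z + ksgn ((i - 1) * (j - 1)) (br y (br x z))"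
    and br_Leibniz: "x \<in> gr i \<Longrightarrow> y \<in> gr j \<Longrightarrow> z \<in> gr l \<Longrightarrow>
      br x (y * z) = br x y * z + ksgn (j * (i - 1)) (y * br x z)"

definition graded_maps ::
  "('k::field \<Rightarrow> 'g::ab_group_add \<Rightarrow> 'g) \<Rightarrow> (int \<Rightarrow> 'g set) \<Rightarrow> int \<Rightarrow> ('g \<Rightarrow> 'g) set"
  where "graded_maps s gr p =
    {f. Vector_Spaces.linear s s f \<and> (\<forall>i. \<forall>x\<in>gr i. f x \<in> gr (i + p))}"

definition graded_bimaps ::
  "('k::field \<Rightarrow> 'g::ab_group_add \<Rightarrow> 'g) \<Rightarrow> (int \<Rightarrow> 'g set) \<Rightarrow> int \<Rightarrow> ('g \<Rightarrow> 'g \<Rightarrow> 'g) set"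
  where "graded_bimaps s gr p =
    {f. bilinear_op s f \<and> (\<forall>i j. \<forall>x\<in>gr i. \<forall>y\<in>gr j. f x y \<in> gr (i + j + p))}"

definition graded_skew :: "(int \<Rightarrow> 'g::ab_group_add set) \<Rightarrow> ('g \<Rightarrow> 'g \<Rightarrow> 'g) \<Rightarrow> bool"
  where "graded_skew gr f \<longleftrightarrow>
    (\<forall>i j. \<forall>x\<in>gr i. \<forall>y\<in>gr j. f x y = - ksgn ((i - 1) * (j - 1)) (f y x))"

section \<open>Quasi-BV structures\<close>

definition qBV ::
  "('k::field \<Rightarrow> 'g::ring \<Rightarrow> 'g) \<Rightarrow> (int \<Rightarrow> 'g set) \<Rightarrow> ('g \<Rightarrow> 'g \<Rightarrow> 'g) \<Rightarrow> ('g \<Rightarrow> 'g) set"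
  where "qBV s gr br = {D \<in> graded_maps s gr (-1).
    (\<forall>i j. \<forall>x\<in>gr i. \<forall>y\<in>gr j.
       D (x * y) - D x * y - ksgn i (x * D y) = ksgn i (br x y)) \<and>
    (\<forall>i j. \<forall>x\<in>gr i. \<forall>y\<in>gr j.
       D (D (x * y)) = D (D x) * y + x * D (D y))}"

section \<open>The corner of the Hochschild--Chevalley bicomplex\<close>

text \<open>
  The parameter \<open>p\<close> is the degree of the cochain in the corner, in the sense of the grading of
  the algebra (a map \<open>f\<close> has degree \<open>p\<close> if it raises the degree by \<open>p\<close>). The bicomplex splits
  according to \<open>p\<close>; since the bracket has degree \<open>-1\<close>, the Chevalley differential goes from
  maps of degree \<open>p\<close> to maps of degree \<open>p - 1\<close>, and the Hochschild differential preserves the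
  degree. Quasi-BV structures concern the part \<open>p = -1\<close>.

  The formulas for the differentials are given for homogeneous \<open>x\<close>; the sums over homogeneous
  components below are their bilinear extensions.
\<close>

definition C00 ::
  "('k::field \<Rightarrow> 'g::ring \<Rightarrow> 'g) \<Rightarrow> (int \<Rightarrow> 'g set) \<Rightarrow> int \<Rightarrow> ('g \<Rightarrow> 'g) set"
  where "C00 s gr p = graded_maps s gr p"

definition C01 ::
  "('k::field \<Rightarrow> 'g::ring \<Rightarrow> 'g) \<Rightarrow> (int \<Rightarrow> 'g set) \<Rightarrow> int \<Rightarrow> ('g \<Rightarrow> 'g \<Rightarrow> 'g) set"
  where "C01 s gr p = graded_bimaps s gr p"

definition C10 ::
  "('k::field \<Rightarrow> 'g::ring \<Rightarrow> 'g) \<Rightarrow> (int \<Rightarrow> 'g set) \<Rightarrow> int \<Rightarrow> ('g \<Rightarrow> 'g \<Rightarrow> 'g) set"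
  where "C10 s gr p = {f \<in> graded_bimaps s gr (p - 1). graded_skew gr f}"

definition dH :: "(int \<Rightarrow> 'g::ring set) \<Rightarrow> int \<Rightarrow> ('g \<Rightarrow> 'g) \<Rightarrow> 'g \<Rightarrow> 'g \<Rightarrow> 'g"
  where "dH gr p f x y =
    (\<Sum>i | hcomp gr x i \<noteq> 0.
        ksgn (i * (p + 1) + p) (hcomp gr x i * f y)
      + ksgn (p + i + 1) (f (hcomp gr x i * y))
      + ksgn (p + i) (f (hcomp gr x i) * y))"

definition dCH ::
  "(int \<Rightarrow> 'g::ring set) \<Rightarrow> ('g \<Rightarrow> 'g \<Rightarrow> 'g) \<Rightarrow> int \<Rightarrow> ('g \<Rightarrow> 'g) \<Rightarrow> 'g \<Rightarrow> 'g \<Rightarrow> 'g"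
  where "dCH gr br p f x y =
    (\<Sum>i | hcomp gr x i \<noteq> 0.
        ksgn ((i - 1) * p) (br (hcomp gr x i) (f y))
      + br (f (hcomp gr x i)) y
      - f (br (hcomp gr x i) y))"

definition ker_dH ::
  "('k::field \<Rightarrow> 'g::ring \<Rightarrow> 'g) \<Rightarrow> (int \<Rightarrow> 'g set) \<Rightarrow> int \<Rightarrow> ('g \<Rightarrow> 'g) set"
  where "ker_dH s gr p = {f \<in> C00 s gr p. dH gr p f = 0}"

definition ker_dCH ::
  "('k::field \<Rightarrow> 'g::ring \<Rightarrow> 'g) \<Rightarrow> (int \<Rightarrow> 'g set) \<Rightarrow> ('g \<Rightarrow> 'g \<Rightarrow> 'g) \<Rightarrow> int
    \<Rightarrow> ('g \<Rightarrow> 'g) set"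
  where "ker_dCH s gr br p = {f \<in> C00 s gr p. dCH gr br p f = 0}"

text \<open>
  In total degree \<open>0\<close> the simple complex is the corner, in total degree \<open>1\<close> it is the sum of the
  two neighbours of the corner, and it vanishes in negative degrees. Hence its \<open>H\<^sup>0\<close> is the
  kernel of the first differential.
\<close>

definition Tot0 ::
  "('k::field \<Rightarrow> 'g::ring \<Rightarrow> 'g) \<Rightarrow> (int \<Rightarrow> 'g set) \<Rightarrow> int \<Rightarrow> ('g \<Rightarrow> 'g) set"
  where "Tot0 s gr p = C00 s gr p"

definition Tot1 ::
  "('k::field \<Rightarrow> 'g::ring \<Rightarrow> 'g) \<Rightarrow> (int \<Rightarrow> 'g set) \<Rightarrow> int
    \<Rightarrow> (('g \<Rightarrow> 'g \<Rightarrow> 'g) \<times> ('g \<Rightarrow> 'g \<Rightarrow> 'g)) set"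
  where "Tot1 s gr p = C01 s gr p \<times> C10 s gr p"

definition dTot ::
  "(int \<Rightarrow> 'g::ring set) \<Rightarrow> ('g \<Rightarrow> 'g \<Rightarrow> 'g) \<Rightarrow> int \<Rightarrow> ('g \<Rightarrow> 'g)
    \<Rightarrow> ('g \<Rightarrow> 'g \<Rightarrow> 'g) \<times> ('g \<Rightarrow> 'g \<Rightarrow> 'g)"
  where "dTot gr br p f = (dH gr p f, dCH gr br p f)"

definition H0_Tot ::
  "('k::field \<Rightarrow> 'g::ring \<Rightarrow> 'g) \<Rightarrow> (int \<Rightarrow> 'g set) \<Rightarrow> ('g \<Rightarrow> 'g \<Rightarrow> 'g) \<Rightarrow> int
    \<Rightarrow> ('g \<Rightarrow> 'g) set"
  where "H0_Tot s gr br p = {f \<in> Tot0 s gr p. dTot gr br p f = (0, 0)}"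

section \<open>One-forms and two-forms of a graded algebra\<close>

definition Omega1 ::
  "('k::field \<Rightarrow> 'g::ring \<Rightarrow> 'g) \<Rightarrow> (int \<Rightarrow> 'g set) \<Rightarrow> ('g \<Rightarrow> 'g) set"
  where "Omega1 s gr = {f \<in> graded_maps s gr (-1).
    \<forall>i j. \<forall>x\<in>gr i. \<forall>y\<in>gr j. f (x * y) = ksgn (i * (-1)) (x * f y) + f x * y}"

definition Omega2 ::
  "('k::field \<Rightarrow> 'g::ring \<Rightarrow> 'g) \<Rightarrow> (int \<Rightarrow> 'g set) \<Rightarrow> ('g \<Rightarrow> 'g \<Rightarrow> 'g) set"
  where "Omega2 s gr = {f \<in> graded_bimaps s gr (-2). graded_skew gr f \<and>
    (\<forall>i j l. \<forall>x\<in>gr i. \<forall>y\<in>gr j. \<forall>z\<in>gr l.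
       f x (y * z) = ksgn (j * (-2 + i)) (y * f x z) + f x y * z)}"

definition dOmega ::
  "(int \<Rightarrow> 'g::ring set) \<Rightarrow> ('g \<Rightarrow> 'g \<Rightarrow> 'g) \<Rightarrow> ('g \<Rightarrow> 'g) \<Rightarrow> 'g \<Rightarrow> 'g \<Rightarrow> 'g"
  where "dOmega gr br = dCH gr br (-1)"

definition Omega1_cl ::
  "('k::field \<Rightarrow> 'g::ring \<Rightarrow> 'g) \<Rightarrow> (int \<Rightarrow> 'g set) \<Rightarrow> ('g \<Rightarrow> 'g \<Rightarrow> 'g) \<Rightarrow> ('g \<Rightarrow> 'g) set"
  where "Omega1_cl s gr br = {f \<in> Omega1 s gr. dOmega gr br f = 0}"

section \<open>Torsors of operators\<close>

text \<open>
  \<open>V\<close> and \<open>S\<close> consist of functions with values in a \<open>k\<close>-vector space with scalar multiplication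
  \<open>s\<close>; \<open>V\<close> acts by pointwise addition, so the axioms of an action are automatic. As usual for
  torsors of BV structures, the empty set is allowed (there may be no such structure at all).
\<close>

definition pointwise :: "('k \<Rightarrow> 'y \<Rightarrow> 'y) \<Rightarrow> 'k \<Rightarrow> ('x \<Rightarrow> 'y) \<Rightarrow> 'x \<Rightarrow> 'y"
  where "pointwise s r f = (\<lambda>x. s r (f x))"

definition additive_torsor ::
  "('k::field \<Rightarrow> 'y::ab_group_add \<Rightarrow> 'y) \<Rightarrow> ('x \<Rightarrow> 'y) set \<Rightarrow> ('x \<Rightarrow> 'y) set \<Rightarrow> bool"
  where "additive_torsor s V S \<longleftrightarrow>
    module.subspace (pointwise s) V \<and>
    (\<forall>D\<in>S. \<forall>f\<in>V. D + f \<in> S) \<and>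
    (\<forall>D\<in>S. \<forall>D'\<in>S. \<exists>!f. f \<in> V \<and> D' = D + f)"

text \<open>\<open>\<phi>\<close> is an isomorphism of torsors over the isomorphism \<open>\<psi>\<close> of vector spaces.\<close>

definition torsor_iso ::
  "('k::field \<Rightarrow> 'y::ab_group_add \<Rightarrow> 'y) \<Rightarrow> ('x \<Rightarrow> 'y) set \<Rightarrow> ('x \<Rightarrow> 'y) set
   \<Rightarrow> ('k \<Rightarrow> 'w::ab_group_add \<Rightarrow> 'w) \<Rightarrow> ('z \<Rightarrow> 'w) set \<Rightarrow> ('z \<Rightarrow> 'w) set
   \<Rightarrow> (('x \<Rightarrow> 'y) \<Rightarrow> 'z \<Rightarrow> 'w) \<Rightarrow> (('x \<Rightarrow> 'y) \<Rightarrow> 'z \<Rightarrow> 'w) \<Rightarrow> bool"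
  where "torsor_iso s V S s' V' S' \<psi> \<phi> \<longleftrightarrow>
    bij_betw \<psi> V V' \<and>
    (\<forall>f\<in>V. \<forall>g\<in>V. \<psi> (f + g) = \<psi> f + \<psi> g) \<and>
    (\<forall>r. \<forall>f\<in>V. \<psi> (pointwise s r f) = pointwise s' r (\<psi> f)) \<and>
    bij_betw \<phi> S S' \<and>
    (\<forall>D\<in>S. \<forall>f\<in>V. \<phi> (D + f) = \<phi> D + \<psi> f)"

section \<open>Lie algebroids\<close>

text \<open>The \<open>k\<close>-structure of the \<open>A\<close>-module \<open>T\<close>, for a \<open>k\<close>-algebra \<open>A\<close>.\<close>

definition restrict_scalars ::
  "('k \<Rightarrow> 'a::comm_ring_1 \<Rightarrow> 'a) \<Rightarrow> ('a \<Rightarrow> 't \<Rightarrow> 't) \<Rightarrow> 'k \<Rightarrow> 't \<Rightarrow> 't"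
  where "restrict_scalars sA sT r t = sT (sA r 1) t"

locale lie_algebroid = A: vector_space sA + T: module sT
  for sA :: "'k::field_char_0 \<Rightarrow> 'a::comm_ring_1 \<Rightarrow> 'a"
    and sT :: "'a \<Rightarrow> 't::ab_group_add \<Rightarrow> 't" +
  fixes lb :: "'t \<Rightarrow> 't \<Rightarrow> 't"
    and act :: "'t \<Rightarrow> 'a \<Rightarrow> 'a"
  assumes A_mult_bilinear: "bilinear_op sA (*)"
    and lb_bilinear: "bilinear_op (restrict_scalars sA sT) lb"
    and lb_alternating: "lb t t = 0"
    and lb_Jacobi: "lb t (lb u v) = lb (lb t u) v + lb u (lb t v)"
    and act_linear: "Vector_Spaces.linear sA sA (act t)"
    and act_derivation: "act t (a * b) = act t a * b + a * act t b"
    and act_linear_left: "Vector_Spaces.linear (restrict_scalars sA sT) sA (\<lambda>t. act t a)"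
    and act_lb: "act (lb t u) a = act t (act u a) - act u (act t a)"
    and act_scale: "act (sT a t) b = a * act t b"
    and lb_scale: "lb t (sT a u) = sT a (lb t u) + sT (act t a) u"

definition BV ::
  "('k::field \<Rightarrow> 'a::comm_ring_1 \<Rightarrow> 'a) \<Rightarrow> ('a \<Rightarrow> 't::ab_group_add \<Rightarrow> 't)
   \<Rightarrow> ('t \<Rightarrow> 't \<Rightarrow> 't) \<Rightarrow> ('t \<Rightarrow> 'a \<Rightarrow> 'a) \<Rightarrow> ('t \<Rightarrow> 'a) set"
  where "BV sA sT lb act = {c. Vector_Spaces.linear (restrict_scalars sA sT) sA c \<and>
    (\<forall>a t. c (sT a t) = a * c t + act t a) \<and>
    (\<forall>t u. c (lb t u) = act t (c u) - act u (c t))}"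

definition Omega1_cl_T ::
  "('a::comm_ring_1 \<Rightarrow> 't::ab_group_add \<Rightarrow> 't)
   \<Rightarrow> ('t \<Rightarrow> 't \<Rightarrow> 't) \<Rightarrow> ('t \<Rightarrow> 'a \<Rightarrow> 'a) \<Rightarrow> ('t \<Rightarrow> 'a) set"
  where "Omega1_cl_T sT lb act = {\<omega>. module_hom sT (*) \<omega> \<and>
    (\<forall>t u. \<omega> (lb t u) - act t (\<omega> u) + act u (\<omega> t) = 0)}"

section \<open>The exterior algebra of a module\<close>

text \<open>
  The exterior algebra is the quotient of the tensor algebra of the \<open>A\<close>-module \<open>T\<close> by the
  two-sided ideal generated by the squares $t \otimes t$. It is presented here as a quotient of
  the \<open>k\<close>-vector space with basis the words \<open>(a, [t\<^sub>1, \<dots>, t\<^sub>n])\<close>, where such a word stands for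
  $a\, t_1 \cdots t_n$. The first four families of relations present the tensor algebra over \<open>A\<close>
  and the last one the ideal; all of them are stable under multiplication by words.
\<close>

type_synonym ('a, 't) ext_word = "'a \<times> 't list"

abbreviation word_of :: "'a \<Rightarrow> 't list \<Rightarrow> ('a, 't) ext_word \<Rightarrow>\<^sub>0 'k::field"
  where "word_of a ts \<equiv> Poly_Mapping.single (a, ts) 1"

abbreviation free_scale :: "'k::field \<Rightarrow> ('w \<Rightarrow>\<^sub>0 'k) \<Rightarrow> ('w \<Rightarrow>\<^sub>0 'k)"
  where "free_scale r \<equiv> Poly_Mapping.map (\<lambda>c. r * c)"

definition ext_generators ::
  "('k::field \<Rightarrow> 'a::comm_ring_1 \<Rightarrow> 'a) \<Rightarrow> ('a \<Rightarrow> 't::ab_group_add \<Rightarrow> 't)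
    \<Rightarrow> (('a, 't) ext_word \<Rightarrow>\<^sub>0 'k) set"
  where "ext_generators sA sT =
      {word_of (a + b) ts - word_of a ts - word_of b ts | a b ts. True}
    \<union> {word_of (sA r a) ts - free_scale r (word_of a ts) | r a ts. True}
    \<union> {word_of a (us @ [t + t'] @ vs) - word_of a (us @ [t] @ vs) - word_of a (us @ [t'] @ vs)
        | a us t t' vs. True}
    \<union> {word_of a (us @ [sT b t] @ vs) - word_of (a * b) (us @ [t] @ vs) | a b us t vs. True}
    \<union> {word_of a (us @ [t, t] @ vs) | a us t vs. True}"

definition ext_relations ::
  "('k::field \<Rightarrow> 'a::comm_ring_1 \<Rightarrow> 'a) \<Rightarrow> ('a \<Rightarrow> 't::ab_group_add \<Rightarrow> 't)
    \<Rightarrow> (('a, 't) ext_word \<Rightarrow>\<^sub>0 'k) set"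
  where "ext_relations sA sT = module.span free_scale (ext_generators sA sT)"

definition word_value :: "('a \<Rightarrow> 'g::ring) \<Rightarrow> ('t \<Rightarrow> 'g) \<Rightarrow> ('a, 't) ext_word \<Rightarrow> 'g"
  where "word_value iA iT w = foldl (\<lambda>x t. x * iT t) (iA (fst w)) (snd w)"

definition free_value ::
  "('k::field \<Rightarrow> 'g::ring \<Rightarrow> 'g) \<Rightarrow> ('a \<Rightarrow> 'g) \<Rightarrow> ('t \<Rightarrow> 'g)
    \<Rightarrow> (('a, 't) ext_word \<Rightarrow>\<^sub>0 'k) \<Rightarrow> 'g"
  where "free_value sG iA iT P =
    (\<Sum>w\<in>Poly_Mapping.keys P. sG (Poly_Mapping.lookup P w) (word_value iA iT w))"

text \<open>
  The graded algebra \<open>G\<close>, with the maps \<open>iA : A \<rightarrow> G\<close> and \<open>iT : T \<rightarrow> G\<close>, is the exterior algebra: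
  evaluation of words identifies \<open>G\<close> with the quotient of the free space by the relations, the
  product being the concatenation of words and the degree being the length of words. (The
  quotient depends on the scalar multiplications, which are terms, so it cannot be a type.)
\<close>

locale exterior_algebra = G: vector_space sG
  for sA :: "'k::field_char_0 \<Rightarrow> 'a::comm_ring_1 \<Rightarrow> 'a"
    and sT :: "'a \<Rightarrow> 't::ab_group_add \<Rightarrow> 't"
    and sG :: "'k \<Rightarrow> 'g::ring \<Rightarrow> 'g" +
  fixes gr :: "int \<Rightarrow> 'g set"
    and iA :: "'a \<Rightarrow> 'g"
    and iT :: "'t \<Rightarrow> 'g"
  assumes G_mult_bilinear: "bilinear_op sG (*)"
    and iA_linear: "Vector_Spaces.linear sA sG iA"
    and iA_mult: "iA (a * b) = iA a * iA b"
    and iA_one: "iA 1 * x = x"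
    and iA_central: "iA a * x = x * iA a"
    and iT_add: "iT (t + u) = iT t + iT u"
    and iT_scale: "iT (sT a t) = iA a * iT t"
    and generated: "surj (free_value sG iA iT)"
    and presented: "{P. free_value sG iA iT P = 0} = ext_relations sA sT"
    and gr_words: "gr i = G.span {word_value iA iT w | w. int (length (snd w)) = i}"

text \<open>
  The Schouten--Nijenhuis algebra: the exterior algebra with its Gerstenhaber bracket that extends
  the bracket of \<open>T\<close> and the action of \<open>T\<close> on \<open>A\<close> (these conditions determine the bracket).
\<close>

locale Schouten_Nijenhuis_algebra =
  lie_algebroid sA sT lb act +
  exterior_algebra sA sT sG gr iA iT +
  Gerstenhaber_algebra sG gr br
  for sA :: "'k::field_char_0 \<Rightarrow> 'a::comm_ring_1 \<Rightarrow> 'a"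
    and sT :: "'a \<Rightarrow> 't::ab_group_add \<Rightarrow> 't"
    and lb :: "'t \<Rightarrow> 't \<Rightarrow> 't"
    and act :: "'t \<Rightarrow> 'a \<Rightarrow> 'a"
    and sG :: "'k \<Rightarrow> 'g::ring \<Rightarrow> 'g"
    and gr :: "int \<Rightarrow> 'g set"
    and iA :: "'a \<Rightarrow> 'g"
    and iT :: "'t \<Rightarrow> 'g"
    and br :: "'g \<Rightarrow> 'g \<Rightarrow> 'g" +
  assumes br_T_T: "br (iT t) (iT u) = iT (lb t u)"
    and br_T_A: "br (iT t) (iA a) = iA (act t a)"

text \<open>
  The identification of operators on the exterior algebra with operators \<open>T \<rightarrow> A\<close> is restriction
  to \<open>T\<close> up to the sign \<open>-1\<close>. The sign is forced by the conventions: a quasi-BV structure \<open>D\<close>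
  satisfies $D(a t) = a D(t) + [a, t] = a D(t) - t(a)$, whereas $c(a t) = a c(t) + t(a)$ for a
  BV structure \<open>c\<close>. The map \<open>iA\<close> identifies \<open>A\<close> with the degree \<open>0\<close> part.
\<close>

definition neg_restrict :: "('a \<Rightarrow> 'g::ring) \<Rightarrow> ('t \<Rightarrow> 'g) \<Rightarrow> ('g \<Rightarrow> 'g) \<Rightarrow> 't \<Rightarrow> 'a::ab_group_add"
  where "neg_restrict iA iT D = (\<lambda>t. - inv iA (D (iT t)))"

end

theory Submission
  imports Defs
begin

text \<open>
  A quasi-BV structure is subject to one condition that is quadratic in it, namely that its square
  is a derivation; so it is not evident that these structures form an affine space. For an
  operator \<open>D\<close> of degree \<open>-1\<close> that satisfies the first-order identity, however, the defect of \<open>D\<^sup>2\<close> at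
  \<open>(x, y)\<close> is, up to sign, \<open>[D x, y] \<plusminus> [x, D y] - D [x, y]\<close>, the Chevalley differential of \<open>D\<close>
  (lemma \<open>square_defect\<close>). Hence quasi-BV structures are the solutions of
  \<^item> \<open>D (x y) = D x y \<plusminus> x D y \<plusminus> e [x, y]\<close> and
  \<^item> \<open>dCH D = 0\<close>

  with \<open>e = 1\<close>, while for \<open>e = 0\<close> the solutions are the closed one-forms, which are also the common
  kernel of the two differentials leaving the corner of the bicomplex. Both conditions are linear in
  \<open>(D, e)\<close>, so the solution set at any \<open>e\<close> (called \<open>pencil e\<close>) is a torsor under the one at \<open>e = 0\<close>.

  Over a Lie algebroid the operators \<open>c : T \<rightarrow> A\<close> with \<open>c (a t) = a (c t) + e t(a)\<close> and
  \<open>c [t, u] = t (c u) - u (c t)\<close> form a similar family, \<open>pencil_T e\<close>, which contains the BV structures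
  at \<open>e = 1\<close> and the closed one-forms at \<open>e = 0\<close>. The identification of the two torsors is thus a
  single statement for all \<open>e\<close>: \<open>D \<mapsto> - D|T\<close> is a bijection from \<open>pencil e\<close> to \<open>pencil_T e\<close>.

  It is injective because the difference of two operators with the same restriction is a derivation
  that kills \<open>T\<close>, and kills \<open>A\<close> for degree reasons. For surjectivity the product rule is read as a
  recursion defining \<open>D\<close> on words. The result respects the relations of the exterior algebra; for those
  that move a function along a word this is the twisted \<open>A\<close>-linearity of \<open>c\<close> (\<open>op_word_scale\<close>). The
  product rule for arbitrary arguments follows from the case of generators (\<open>bv_rule_word\<close>). Finally, \<open>dCH D\<close> is a
  biderivation by the Jacobi identity (\<open>dCH_Leibniz\<close>), so it is zero as soon as it is zero on pairs of
  elements of \<open>T\<close>, and that is the second condition on \<open>c\<close>.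
\<close>

section \<open>Signs, and torsors cut out by an inhomogeneous linear condition\<close>

lemma ksgn_simps [simp]:
  "ksgn i 0 = 0" "ksgn i (- x) = - ksgn i x" "ksgn i (ksgn j x) = ksgn (i + j) x"
  "ksgn 0 x = x"
  by (auto simp: ksgn_def)

lemma ksgn_eq_zero_iff [simp]: "ksgn i x = 0 \<longleftrightarrow> x = 0"
  by (auto simp: ksgn_def)

lemma ksgn_add: "ksgn i (x + y) = ksgn i x + ksgn i y"
  by (auto simp: ksgn_def)

lemma additive_facts:
  fixes f :: "'x::ab_group_add \<Rightarrow> 'y::ab_group_add"
  assumes "\<And>x y. f (x + y) = f x + f y"
  shows "f 0 = 0" "f (- x) = - f x" "f (x - y) = f x - f y"
proof -
  show 0: "f 0 = 0" using assms[of 0 0] by simp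
  show m: "f (- x) = - f x" for x using assms[of x "- x"] 0 by (simp add: add_eq_0_iff)
  show "f (x - y) = f x - f y" using assms[of x "- y"] m[of y] by simp
qed

text \<open>
  Adding an element of level \<open>0\<close> preserves the level \<open>e\<close>, and the difference of two elements of
  level \<open>e\<close> has level \<open>0\<close>. Think of \<open>P e\<close> as the fibre over \<open>e\<close> of a linear functional on a space of
  pairs \<open>(D, e)\<close>.
\<close>

lemma additive_torsor_pencil:
  fixes P :: "'k::field \<Rightarrow> ('x \<Rightarrow> 'y::ab_group_add) set"
  assumes "vector_space s"
    and combine: "\<And>f g a b q r. f \<in> P a \<Longrightarrow> g \<in> P b \<Longrightarrow>
      (\<lambda>x. s q (f x) + s r (g x)) \<in> P (q * a + r * b)"
    and zero: "0 \<in> P 0"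
  shows "additive_torsor s (P 0) (P e)"
proof -
  interpret vector_space s by fact
  have add: "f + g \<in> P (a + b)" if "f \<in> P a" "g \<in> P b" for f g a b
    using combine[OF that, of 1 1] by (simp add: plus_fun_def)
  have diff: "g - f \<in> P (b - a)" if "f \<in> P a" "g \<in> P b" for f g a b
    using combine[OF that, of "- 1" 1] by (simp add: fun_diff_def)
  have scale: "pointwise s r f \<in> P (r * a)" if "f \<in> P a" for r f a
    using combine[OF that that, of r 0] by (simp add: pointwise_def)
  have mod: "module (pointwise s)"
    by (simp add: module_def pointwise_def fun_eq_iff scale_right_distrib scale_left_distrib)
  have "module.subspace (pointwise s) (P 0)"
    unfolding module.subspace_def[OF mod] using zero add[of _ 0 _ 0] scale[of _ 0] by auto
  moreover have "\<exists>!f. f \<in> P 0 \<and> D' = D + f" if "D \<in> P e" "D' \<in> P e" for D D'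
    using diff[OF that] by (intro ex1I[of _ "D' - D"]) auto
  moreover have "D + f \<in> P e" if "D \<in> P e" "f \<in> P 0" for D f
    using add[OF that] by simp
  ultimately show ?thesis by (simp add: additive_torsor_def)
qed

section \<open>Linear and bilinear maps on a graded algebra\<close>

context Gerstenhaber_algebra
begin

lemma linear_iff_add_scale:
  "Vector_Spaces.linear s s f \<longleftrightarrow>
    (\<forall>x y. f (x + y) = f x + f y) \<and> (\<forall>r x. f (s r x) = s r (f x))"
  using vector_space_axioms by (auto simp: Vector_Spaces.linear_iff)

lemma bilinear_op_iff:
  "bilinear_op s f \<longleftrightarrow>
    (\<forall>x y z. f (x + y) z = f x z + f y z) \<and> (\<forall>x y z. f x (y + z) = f x y + f x z) \<and>
    (\<forall>r x y. f (s r x) y = s r (f x y)) \<and> (\<forall>r x y. f x (s r y) = s r (f x y))"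
  unfolding bilinear_op_def linear_iff_add_scale by blast

lemma mult_scale [simp]: "s r x * y = s r (x * y)" "x * s r y = s r (x * y)"
  using mult_bilinear by (auto simp: bilinear_op_iff)

lemma br_scale [simp]: "br (s r x) y = s r (br x y)" "br x (s r y) = s r (br x y)"
  using br_bilinear by (auto simp: bilinear_op_iff)

lemma br_add: "br (x + y) z = br x z + br y z" "br x (y + z) = br x y + br x z"
  using br_bilinear by (auto simp: bilinear_op_iff)

lemmas br_right = additive_facts[of "br x" for x, OF br_add(2)]
lemmas br_left = additive_facts[of "\<lambda>x. br x y" for y, OF br_add(1)]

lemma br_simps [simp]:
  "br 0 y = 0" "br x 0 = 0" "br (- x) y = - br x y" "br x (- y) = - br x y"
  by (rule br_right br_left)+

lemma br_ksgn [simp]: "br (ksgn i x) y = ksgn i (br x y)" "br x (ksgn i y) = ksgn i (br x y)"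
  by (auto simp: ksgn_def)

lemma scale_ksgn [simp]: "s r (ksgn i x) = ksgn i (s r x)"
  by (auto simp: ksgn_def)

lemma graded_maps_iff:
  "f \<in> graded_maps s gr p \<longleftrightarrow> (\<forall>x y. f (x + y) = f x + f y) \<and> (\<forall>r x. f (s r x) = s r (f x)) \<and>
    (\<forall>i. \<forall>x\<in>gr i. f x \<in> gr (i + p))"
  unfolding graded_maps_def linear_iff_add_scale by simp

lemma gr_zero [simp]: "0 \<in> gr i" and gr_neg: "x \<in> gr i \<Longrightarrow> - x \<in> gr i"
  and gr_add: "x \<in> gr i \<Longrightarrow> y \<in> gr i \<Longrightarrow> x + y \<in> gr i"
  and gr_diff: "x \<in> gr i \<Longrightarrow> y \<in> gr i \<Longrightarrow> x - y \<in> gr i"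
  and gr_scale: "x \<in> gr i \<Longrightarrow> s r x \<in> gr i"
  using gr_subspace[of i]
  by (auto intro: subspace_0 subspace_neg subspace_add subspace_diff subspace_scale)

lemma gr_ksgn: "x \<in> gr i \<Longrightarrow> ksgn j x \<in> gr i"
  by (auto simp: ksgn_def gr_neg)

lemma hcomp_decomposition: "is_decomposition gr x (hcomp gr x)"
  unfolding hcomp_def by (rule theI'[OF gr_decomposition])

lemma hcomp_eqI: "is_decomposition gr x c \<Longrightarrow> hcomp gr x = c"
  using hcomp_decomposition gr_decomposition by blast

lemma hcomp_mem: "hcomp gr x i \<in> gr i"
  and finite_hcomp [simp]: "finite {i. hcomp gr x i \<noteq> 0}"
  and sum_hcomp: "(\<Sum>i | hcomp gr x i \<noteq> 0. hcomp gr x i) = x"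
  using hcomp_decomposition[of x] by (auto simp: is_decomposition_def)

lemma hcomp_eq_sumI:
  assumes "\<And>i. c i \<in> gr i" "finite F" "\<And>i. i \<notin> F \<Longrightarrow> c i = 0" "sum c F = x"
  shows "hcomp gr x = c"
proof (rule hcomp_eqI)
  have sub: "{i. c i \<noteq> 0} \<subseteq> F" using assms(3) by blast
  have "sum c {i. c i \<noteq> 0} = sum c F"
    by (rule sum.mono_neutral_left) (use assms sub in auto)
  then show "is_decomposition gr x c"
    using assms finite_subset[OF sub] by (simp add: is_decomposition_def)
qed

lemma hcomp_homogeneous: "x \<in> gr i \<Longrightarrow> hcomp gr x = (\<lambda>j. if j = i then x else 0)"
  by (rule hcomp_eq_sumI[where F = "{i}"]) auto

lemma sum_hcomp_superset:
  assumes "finite F" "{i. hcomp gr x i \<noteq> 0} \<subseteq> F" "\<And>i. b i 0 = 0"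
  shows "(\<Sum>i | hcomp gr x i \<noteq> 0. b i (hcomp gr x i)) = (\<Sum>i\<in>F. b i (hcomp gr x i))"
  by (rule sum.mono_neutral_left) (use assms in auto)

lemma hcomp_add: "hcomp gr (x + y) = (\<lambda>i. hcomp gr x i + hcomp gr y i)"
proof (rule hcomp_eq_sumI)
  let ?F = "{i. hcomp gr x i \<noteq> 0} \<union> {i. hcomp gr y i \<noteq> 0}"
  show "finite ?F" by simp
  have "sum (hcomp gr x) ?F = x" "sum (hcomp gr y) ?F = y"
    using sum_hcomp_superset[of ?F x "\<lambda>_ x. x"] sum_hcomp_superset[of ?F y "\<lambda>_ x. x"]
    by (simp_all add: sum_hcomp)
  then show "(\<Sum>i\<in>?F. hcomp gr x i + hcomp gr y i) = x + y"
    by (simp add: sum.distrib)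
qed (auto intro: gr_add hcomp_mem)

lemma hcomp_scale: "hcomp gr (s r x) = (\<lambda>i. s r (hcomp gr x i))"
proof (rule hcomp_eq_sumI)
  show "(\<Sum>i | hcomp gr x i \<noteq> 0. s r (hcomp gr x i)) = s r x"
    by (simp add: scale_sum_right[symmetric] sum_hcomp)
qed (auto intro: gr_scale hcomp_mem)

lemma homogeneous_induct [consumes 0, case_names homogeneous add]:
  assumes h: "\<And>i x. x \<in> gr i \<Longrightarrow> P x" and a: "\<And>x y. P x \<Longrightarrow> P y \<Longrightarrow> P (x + y)"
  shows "P x"
proof -
  have "P (sum (hcomp gr x) F)" if "finite F" for F
    using that by (induction F rule: finite_induct) (auto intro: h hcomp_mem a)
  from this[of "{i. hcomp gr x i \<noteq> 0}"] show ?thesis by (simp add: sum_hcomp)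
qed

text \<open>
  The differentials of the corner of the bicomplex are given by formulas whose signs depend on the
  degree of the first argument; this is the linear extension of such a family of maps.
\<close>

definition componentwise :: "(int \<Rightarrow> 'g \<Rightarrow> 'g) \<Rightarrow> 'g \<Rightarrow> 'g"
  where "componentwise b x = (\<Sum>i | hcomp gr x i \<noteq> 0. b i (hcomp gr x i))"

lemma componentwise_homogeneous:
  assumes "\<And>i. b i 0 = 0" "x \<in> gr i"
  shows "componentwise b x = b i x"
  unfolding componentwise_def hcomp_homogeneous[OF assms(2)]
  by (cases "x = 0") (auto simp: assms(1) if_distrib cong: if_cong)

lemma componentwise_add:
  assumes b: "\<And>i x y. b i (x + y) = b i x + b i y"
  shows "componentwise b (x + y) = componentwise b x + componentwise b y"
proof -
  let ?F = "{i. hcomp gr x i \<noteq> 0} \<union> {i. hcomp gr y i \<noteq> 0}"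
  have 0: "b i 0 = 0" for i by (rule additive_facts) (rule b)
  have "componentwise b z = (\<Sum>i\<in>?F. b i (hcomp gr z i))" if "{i. hcomp gr z i \<noteq> 0} \<subseteq> ?F" for z
    unfolding componentwise_def by (rule sum_hcomp_superset) (use that 0 in auto)
  moreover have "{i. hcomp gr (x + y) i \<noteq> 0} \<subseteq> ?F" by (auto simp: hcomp_add)
  ultimately show ?thesis by (simp add: hcomp_add b sum.distrib)
qed

lemma componentwise_scale:
  assumes b: "\<And>i r x. b i (s r x) = s r (b i x)"
  shows "componentwise b (s r x) = s r (componentwise b x)"
proof -
  have 0: "b i 0 = 0" for i using b[of i 0 0] by simp
  have "componentwise b (s r x) = (\<Sum>i | hcomp gr x i \<noteq> 0. b i (hcomp gr (s r x) i))"
    unfolding componentwise_def by (rule sum_hcomp_superset) (auto simp: 0 hcomp_scale)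
  then show ?thesis by (simp add: componentwise_def hcomp_scale b scale_sum_right)
qed

lemma componentwise_bilinear:
  assumes "\<And>i. bilinear_op s (b i)"
  shows "bilinear_op s (\<lambda>x y. componentwise (\<lambda>i x. b i x y) x)"
proof -
  note b = assms[unfolded bilinear_op_iff]
  show ?thesis
    unfolding bilinear_op_iff
  proof (intro conjI allI)
    fix x y z r
    show "componentwise (\<lambda>i x. b i x z) (x + y) =
        componentwise (\<lambda>i x. b i x z) x + componentwise (\<lambda>i x. b i x z) y"
      by (rule componentwise_add) (use b in blast)
    show "componentwise (\<lambda>i x. b i x y) (s r x) = s r (componentwise (\<lambda>i x. b i x y) x)"
      by (rule componentwise_scale) (use b in blast)
    show "componentwise (\<lambda>i x. b i x (y + z)) x =
        componentwise (\<lambda>i x. b i x y) x + componentwise (\<lambda>i x. b i x z) x"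
      using b by (simp add: componentwise_def sum.distrib)
    show "componentwise (\<lambda>i x. b i x (s r y)) x = s r (componentwise (\<lambda>i x. b i x y) x)"
      using b by (simp add: componentwise_def scale_sum_right)
  qed
qed

lemma bilinear_ext:
  assumes "bilinear_op s f" "bilinear_op s g"
    and eq: "\<And>i j x y. x \<in> gr i \<Longrightarrow> y \<in> gr j \<Longrightarrow> f x y = g x y"
  shows "f = g"
proof -
  note b = assms(1,2)[unfolded bilinear_op_iff]
  have hom: "f x y = g x y" if "x \<in> gr i" for i x y
    by (induction y rule: homogeneous_induct) (use eq that b in auto)
  have "f x y = g x y" for x y
    by (induction x rule: homogeneous_induct) (use hom b in auto)
  then show ?thesis by blast
qed

lemma bilinear_zero: "bilinear_op s 0"
  by (simp add: bilinear_op_iff)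

section \<open>The pencil joining one-forms to quasi-BV structures\<close>

lemma br_Leibniz_left:
  assumes "x \<in> gr i" "y \<in> gr j" "z \<in> gr l"
  shows "br (x * y) z = x * br y z + ksgn (j * (l - 1)) (br x z * y)"
proof -
  have "br (x * y) z = - ksgn ((i + j - 1) * (l - 1)) (br z (x * y))"
    by (rule br_skew) (use assms gr_mult in auto)
  also have "br z (x * y) = br z x * y + ksgn (i * (l - 1)) (x * br z y)"
    by (rule br_Leibniz) (use assms in auto)
  also have "br z x = - ksgn ((l - 1) * (i - 1)) (br x z)"
    by (rule br_skew) (use assms in auto)
  also have "br z y = - ksgn ((l - 1) * (j - 1)) (br y z)"
    by (rule br_skew) (use assms in auto)
  finally show ?thesis
    by (cases "even i"; cases "even j"; cases "even l") (auto simp: ksgn_def)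
qed

text \<open>
  The first identity of a quasi-BV structure with the bracket multiplied by a scalar \<open>e\<close>, at a
  single pair of arguments; \<open>i\<close> stands for the degree of \<open>x\<close>. For \<open>e = 0\<close> it says that \<open>D\<close> acts as a
  derivation of degree \<open>-1\<close>. Keeping \<open>e\<close> free treats derivations and BV operators by one
  computation each time, in the way that \<open>\<lambda>\<close>-connections interpolate between Higgs fields and
  connections.
\<close>

definition bv_rule :: "'k \<Rightarrow> ('g \<Rightarrow> 'g) \<Rightarrow> 'g \<Rightarrow> int \<Rightarrow> 'g \<Rightarrow> bool"
  where "bv_rule e D x i y \<longleftrightarrow> D (x * y) = D x * y + ksgn i (x * D y) + ksgn i (s e (br x y))"

text \<open>
  The identity needs to be known for generators in the first argument only. Expanding
  \<open>D (u (v w))\<close> in two ways, the terms with a bracket agree because the bracket is a derivation in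
  each of its arguments and the product is graded commutative.
\<close>

lemma bv_rule_mult:
  assumes u: "u \<in> gr l" "\<And>w n. w \<in> gr n \<Longrightarrow> bv_rule e D u l w"
    and v: "v \<in> gr m" "\<And>w n. w \<in> gr n \<Longrightarrow> bv_rule e D v m w" and w: "w \<in> gr n"
  shows "bv_rule e D (u * v) (l + m) w"
proof -
  have 1: "D (u * (v * w)) = D u * (v * w) + ksgn l (u * D (v * w)) + ksgn l (s e (br u (v * w)))"
    using u(2)[OF gr_mult[OF v(1) w]] by (simp add: bv_rule_def)
  have 2: "D (v * w) = D v * w + ksgn m (v * D w) + ksgn m (s e (br v w))"
    using v(2)[OF w] by (simp add: bv_rule_def)
  have 3: "D (u * v) = D u * v + ksgn l (u * D v) + ksgn l (s e (br u v))"
    using u(2)[OF v(1)] by (simp add: bv_rule_def)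
  have 4: "br u (v * w) = br u v * w + ksgn (m * (l - 1)) (v * br u w)"
    by (rule br_Leibniz) (use u v w in auto)
  have 5: "br (u * v) w = u * br v w + ksgn (m * (n - 1)) (br u w * v)"
    by (rule br_Leibniz_left) (use u v w in auto)
  have 6: "v * br u w = ksgn (m * (l + n - 1)) (br u w * v)"
    by (rule graded_commute[OF v(1) gr_br[OF u(1) w]])
  show ?thesis
    unfolding bv_rule_def mult.assoc 1 2 3 4 5 6
    by (cases "even l"; cases "even m"; cases "even n")
      (auto simp: ksgn_def algebra_simps scale_right_distrib)
qed

definition pencil :: "'k \<Rightarrow> ('g \<Rightarrow> 'g) set"
  where "pencil e = {D \<in> graded_maps s gr (-1).
    (\<forall>i j. \<forall>x\<in>gr i. \<forall>y\<in>gr j. bv_rule e D x i y) \<and> dCH gr br (-1) D = 0}"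

lemma dCH_homogeneous:
  assumes "D \<in> graded_maps s gr p" "x \<in> gr i"
  shows "dCH gr br p D x y = ksgn ((i - 1) * p) (br x (D y)) + br (D x) y - D (br x y)"
proof -
  have D: "D (x + y) = D x + D y" for x y using assms(1) by (simp add: graded_maps_iff)
  show ?thesis
    unfolding dCH_def
    using componentwise_homogeneous[of "\<lambda>i x. ksgn ((i - 1) * p) (br x (D y)) + br (D x) y - D (br x y)" x i]
      assms(2) additive_facts(1)[of D, OF D]
    by (simp add: componentwise_def)
qed

lemma dH_homogeneous:
  assumes "D \<in> graded_maps s gr p" "x \<in> gr i"
  shows "dH gr p D x y = ksgn (i * (p + 1) + p) (x * D y) + ksgn (p + i + 1) (D (x * y)) + ksgn (p + i) (D x * y)"
proof -
  have D: "D (x + y) = D x + D y" for x y using assms(1) by (simp add: graded_maps_iff)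
  show ?thesis
    unfolding dH_def
    using componentwise_homogeneous[of "\<lambda>i x. ksgn (i * (p + 1) + p) (x * D y)
        + ksgn (p + i + 1) (D (x * y)) + ksgn (p + i) (D x * y)" x i]
      assms(2) additive_facts(1)[of D, OF D]
    by (simp add: componentwise_def)
qed

lemma dCH_bilinear:
  assumes "D \<in> graded_maps s gr p"
  shows "bilinear_op s (dCH gr br p D)"
proof -
  have D: "D (x + y) = D x + D y" "D (s r x) = s r (D x)" for x y r
    using assms by (auto simp: graded_maps_iff)
  have "bilinear_op s (\<lambda>x y. componentwise
      (\<lambda>i x. ksgn ((i - 1) * p) (br x (D y)) + br (D x) y - D (br x y)) x)"
    by (rule componentwise_bilinear)
      (simp add: bilinear_op_iff D br_add ksgn_add scale_right_distrib scale_right_diff_distrib)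
  then show ?thesis by (simp add: componentwise_def dCH_def[abs_def])
qed

lemma dH_bilinear:
  assumes "D \<in> graded_maps s gr p"
  shows "bilinear_op s (dH gr p D)"
proof -
  have D: "D (x + y) = D x + D y" "D (s r x) = s r (D x)" for x y r
    using assms by (auto simp: graded_maps_iff)
  have "bilinear_op s (\<lambda>x y. componentwise
      (\<lambda>i x. ksgn (i * (p + 1) + p) (x * D y) + ksgn (p + i + 1) (D (x * y)) + ksgn (p + i) (D x * y)) x)"
    by (rule componentwise_bilinear)
      (simp add: bilinear_op_iff D distrib_left distrib_right ksgn_add scale_right_distrib)
  then show ?thesis by (simp add: componentwise_def dH_def[abs_def])
qed

lemma dCH_skew:
  assumes D: "D \<in> graded_maps s gr (-1)" and x: "x \<in> gr i" and y: "y \<in> gr j"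
  shows "dCH gr br (-1) D x y = - ksgn ((i - 1) * (j - 1)) (dCH gr br (-1) D y x)"
proof -
  have lin: "D (u + v) = D u + D v" for u v using D by (simp add: graded_maps_iff)
  have neg: "D (- u) = - D u" for u by (rule additive_facts) (rule lin)
  have deg: "D x \<in> gr (i - 1)" "D y \<in> gr (j - 1)" using D x y by (auto simp: graded_maps_iff)
  have "br y (D x) = - ksgn ((j - 1) * (i - 1 - 1)) (br (D x) y)"
       "br (D y) x = - ksgn ((j - 1 - 1) * (i - 1)) (br x (D y))"
       "br y x = - ksgn ((j - 1) * (i - 1)) (br x y)"
    by (rule br_skew; use x y deg in simp)+
  then show ?thesis
    unfolding dCH_homogeneous[OF D x] dCH_homogeneous[OF D y]
    by (cases "even i"; cases "even j") (auto simp: ksgn_def neg)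
qed

lemma dCH_degree:
  assumes D: "D \<in> graded_maps s gr (-1)" and x: "x \<in> gr i" and y: "y \<in> gr j"
  shows "dCH gr br (-1) D x y \<in> gr (i + j - 2)"
proof -
  have deg: "D z \<in> gr (l - 1)" if "z \<in> gr l" for z l using D that by (auto simp: graded_maps_iff)
  show ?thesis
    unfolding dCH_homogeneous[OF D x]
    using gr_br[OF x deg[OF y]] gr_br[OF deg[OF x] y] deg[OF gr_br[OF x y]]
    by (auto intro!: gr_add gr_diff gr_ksgn simp: algebra_simps)
qed

lemma dH_degree:
  assumes D: "D \<in> graded_maps s gr p" and x: "x \<in> gr i" and y: "y \<in> gr j"
  shows "dH gr p D x y \<in> gr (i + j + p)"
proof -
  have deg: "D z \<in> gr (l + p)" if "z \<in> gr l" for z l using D that by (auto simp: graded_maps_iff)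
  show ?thesis
    unfolding dH_homogeneous[OF D x]
    using gr_mult[OF x deg[OF y]] gr_mult[OF deg[OF x] y] deg[OF gr_mult[OF x y]]
    by (auto intro!: gr_add gr_ksgn simp: algebra_simps)
qed

text \<open>
  The operator \<open>dCH D x\<close> is the graded commutator of \<open>D\<close> with \<open>[x, -]\<close>, corrected by \<open>[D x, -]\<close>. A
  commutator of an operator of order 2 and a derivation could have order 2; its failure to be a
  derivation is \<open>e\<close> times the failure of \<open>[x, -]\<close> to be a derivation of the bracket, which vanishes
  by the Jacobi identity. So \<open>dCH D\<close> is determined by its values on algebra generators, and for
  \<open>e = 0\<close> it is a two-form.
\<close>

lemma dCH_Leibniz:
  assumes D: "D \<in> graded_maps s gr (-1)"
    and rule: "\<And>i j x y. x \<in> gr i \<Longrightarrow> y \<in> gr j \<Longrightarrow> bv_rule e D x i y"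
    and x: "x \<in> gr i" and y: "y \<in> gr j" and z: "z \<in> gr l"
  shows "dCH gr br (-1) D x (y * z) =
    ksgn (j * i) (y * dCH gr br (-1) D x z) + dCH gr br (-1) D x y * z"
proof -
  have lin: "D (u + v) = D u + D v" for u v using D by (simp add: graded_maps_iff)
  have sgn: "D (ksgn n u) = ksgn n (D u)" for n u
    using additive_facts(2)[of D, OF lin] by (simp add: ksgn_def)
  have deg: "D x \<in> gr (i - 1)" "D y \<in> gr (j - 1)" "D z \<in> gr (l - 1)"
    using D x y z by (auto simp: graded_maps_iff)
  have 1: "D (y * z) = D y * z + ksgn j (y * D z) + ksgn j (s e (br y z))"
    using rule[OF y z] by (simp add: bv_rule_def)
  have 2: "br x (D y * z) = br x (D y) * z + ksgn ((j - 1) * (i - 1)) (D y * br x z)"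
    by (rule br_Leibniz) (use x z deg in auto)
  have 3: "br x (y * D z) = br x y * D z + ksgn (j * (i - 1)) (y * br x (D z))"
    by (rule br_Leibniz) (use x y deg in auto)
  have 4: "br (D x) (y * z) = br (D x) y * z + ksgn (j * (i - 1 - 1)) (y * br (D x) z)"
    by (rule br_Leibniz) (use z y deg in auto)
  have 5: "br x (y * z) = br x y * z + ksgn (j * (i - 1)) (y * br x z)"
    by (rule br_Leibniz) (use x z y in auto)
  have 6: "D (br x y * z) = D (br x y) * z + ksgn (i + j - 1) (br x y * D z)
      + ksgn (i + j - 1) (s e (br (br x y) z))"
    using rule[OF gr_br[OF x y] z] by (simp add: bv_rule_def)
  have 7: "D (y * br x z) = D y * br x z + ksgn j (y * D (br x z)) + ksgn j (s e (br y (br x z)))"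
    using rule[OF y gr_br[OF x z]] by (simp add: bv_rule_def)
  note J = br_Jacobi[OF x y z]
  show ?thesis
    unfolding dCH_homogeneous[OF D x] 1 5 br_add lin sgn
    unfolding br_ksgn br_scale 2 3 4 6 7 J
    by (cases "even i"; cases "even j")
      (auto simp: ksgn_def algebra_simps scale_right_distrib scale_right_diff_distrib)
qed

text \<open>
  This turns the second identity of a quasi-BV structure, which is quadratic in \<open>D\<close>, into the
  equation \<open>dCH D = 0\<close>, which is linear in \<open>D\<close>. Only for this reason do quasi-BV structures form an
  affine space. The two products \<open>D x * D y\<close> that arise when \<open>D (D (x y))\<close> is expanded cancel, since
  \<open>D\<close> changes the parity of \<open>x\<close>.
\<close>

lemma square_defect:
  assumes D: "D \<in> graded_maps s gr (-1)"
    and rule: "\<And>i j x y. x \<in> gr i \<Longrightarrow> y \<in> gr j \<Longrightarrow> bv_rule 1 D x i y"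
    and x: "x \<in> gr i" and y: "y \<in> gr j"
  shows "D (D (x * y)) = D (D x) * y + x * D (D y) + ksgn (i - 1) (dCH gr br (-1) D x y)"
proof -
  have lin: "D (u + v) = D u + D v" for u v using D by (simp add: graded_maps_iff)
  have sgn: "D (ksgn n u) = ksgn n (D u)" for n u
    using additive_facts(2)[of D, OF lin] by (simp add: ksgn_def)
  have deg: "D x \<in> gr (i - 1)" "D y \<in> gr (j - 1)"
    using D x y by (auto simp: graded_maps_iff)
  note r = rule[unfolded bv_rule_def scale_one]
  show ?thesis
    unfolding dCH_homogeneous[OF D x] r[OF x y] lin sgn r[OF x deg(2)] r[OF deg(1) y]
    by (cases "even i") (auto simp: ksgn_def algebra_simps)
qed

lemma bilinear_eq_zero_iff:
  assumes "bilinear_op s f"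
  shows "f = 0 \<longleftrightarrow> (\<forall>i j. \<forall>x\<in>gr i. \<forall>y\<in>gr j. f x y = 0)"
  using bilinear_ext[OF assms bilinear_zero] by auto

lemma qBV_eq_pencil: "qBV s gr br = pencil 1"
proof -
  have "D \<in> qBV s gr br \<longleftrightarrow> D \<in> pencil 1" if D: "D \<in> graded_maps s gr (-1)" for D
  proof -
    have r: "D (x * y) - D x * y - ksgn i (x * D y) = ksgn i (br x y) \<longleftrightarrow> bv_rule 1 D x i y" for x i y
      by (auto simp: bv_rule_def algebra_simps)
    show ?thesis
    proof (cases "\<forall>i j. \<forall>x\<in>gr i. \<forall>y\<in>gr j. bv_rule 1 D x i y")
      case True
      then have "D (D (x * y)) = D (D x) * y + x * D (D y) \<longleftrightarrow> dCH gr br (-1) D x y = 0"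
        if "x \<in> gr i" "y \<in> gr j" for x y i j
        using square_defect[OF D _ that] by auto
      then have "(\<forall>i j. \<forall>x\<in>gr i. \<forall>y\<in>gr j. D (D (x * y)) = D (D x) * y + x * D (D y))
          \<longleftrightarrow> dCH gr br (-1) D = 0"
        unfolding bilinear_eq_zero_iff[OF dCH_bilinear[OF D]] by blast
      then show ?thesis using True D by (simp add: qBV_def pencil_def r)
    qed (auto simp: qBV_def pencil_def r)
  qed
  moreover have "qBV s gr br \<subseteq> graded_maps s gr (-1)" "pencil 1 \<subseteq> graded_maps s gr (-1)"
    by (auto simp: qBV_def pencil_def)
  ultimately show ?thesis by blast
qed

lemma ker_dH_eq_Omega1: "ker_dH s gr (-1) = Omega1 s gr"
proof -
  have "dH gr (-1) D = 0 \<longleftrightarrow>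
      (\<forall>i j. \<forall>x\<in>gr i. \<forall>y\<in>gr j. D (x * y) = ksgn (i * (-1)) (x * D y) + D x * y)"
    if D: "D \<in> graded_maps s gr (-1)" for D
  proof -
    have "dH gr (-1) D x y = 0 \<longleftrightarrow> D (x * y) = ksgn (i * (-1)) (x * D y) + D x * y"
      if "x \<in> gr i" for x y i
      unfolding dH_homogeneous[OF D that]
      by (cases "even i") (auto simp: ksgn_def algebra_simps add_eq_0_iff2)
    then show ?thesis unfolding bilinear_eq_zero_iff[OF dH_bilinear[OF D]] by blast
  qed
  then show ?thesis by (auto simp: ker_dH_def C00_def Omega1_def)
qed

lemma Omega1_cl_eq_pencil: "Omega1_cl s gr br = pencil 0"
proof -
  have "bv_rule 0 D x i y \<longleftrightarrow> D (x * y) = ksgn (i * (-1)) (x * D y) + D x * y" for D x i y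
    by (simp add: bv_rule_def ksgn_def add.commute)
  then show ?thesis
    by (auto simp: Omega1_cl_def Omega1_def pencil_def dOmega_def)
qed

lemma kernels_eq_Omega1_cl: "ker_dH s gr (-1) \<inter> ker_dCH s gr br (-1) = Omega1_cl s gr br"
  unfolding ker_dH_eq_Omega1 by (auto simp: ker_dCH_def C00_def Omega1_cl_def Omega1_def dOmega_def)

lemma H0_Tot_eq_kernels: "H0_Tot s gr br p = ker_dH s gr p \<inter> ker_dCH s gr br p"
  by (auto simp: H0_Tot_def Tot0_def dTot_def ker_dH_def ker_dCH_def)

lemma dCH_in_C10:
  assumes D: "D \<in> graded_maps s gr (-1)"
  shows "dCH gr br (-1) D \<in> C10 s gr (-1)"
proof -
  have "dCH gr br (-1) D x y \<in> gr (i + j + (- 1 - 1))" if "x \<in> gr i" "y \<in> gr j" for x y i j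
    using dCH_degree[OF D that] by simp
  with dCH_bilinear[OF D] dCH_skew[OF D] show ?thesis
    unfolding C10_def graded_bimaps_def graded_skew_def by blast
qed

lemma dTot_maps: "dTot gr br (-1) \<in> Tot0 s gr (-1) \<rightarrow> Tot1 s gr (-1)"
proof
  fix D assume "D \<in> Tot0 s gr (-1)"
  then have D: "D \<in> graded_maps s gr (-1)" by (simp add: Tot0_def C00_def)
  have "dH gr (-1) D \<in> C01 s gr (-1)"
    using dH_bilinear[OF D] dH_degree[OF D] unfolding C01_def graded_bimaps_def by blast
  then show "dTot gr br (-1) D \<in> Tot1 s gr (-1)"
    using dCH_in_C10[OF D] by (simp add: Tot1_def dTot_def)
qed

lemma dOmega_maps: "dOmega gr br \<in> Omega1 s gr \<rightarrow> Omega2 s gr"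
proof
  fix f assume f: "f \<in> Omega1 s gr"
  then have D: "f \<in> graded_maps s gr (-1)" by (simp add: Omega1_def)
  have rule: "bv_rule 0 f x i y" if "x \<in> gr i" "y \<in> gr j" for x y i j
  proof -
    have "f (x * y) = ksgn (i * (-1)) (x * f y) + f x * y"
      using f that unfolding Omega1_def by blast
    then show ?thesis by (simp add: bv_rule_def ksgn_def)
  qed
  have "ksgn (j * (- 2 + i)) x = ksgn (j * i) x" for i j and x :: 'g
    by (auto simp: ksgn_def)
  moreover have "dCH gr br (-1) f x (y * z) = ksgn (j * i) (y * dCH gr br (-1) f x z)
      + dCH gr br (-1) f x y * z" if "x \<in> gr i" "y \<in> gr j" "z \<in> gr l" for x y z i j l
    by (rule dCH_Leibniz[OF D _ that, where e = 0]) (rule rule)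
  ultimately have "dCH gr br (-1) f x (y * z) = ksgn (j * (- 2 + i)) (y * dCH gr br (-1) f x z)
      + dCH gr br (-1) f x y * z" if "x \<in> gr i" "y \<in> gr j" "z \<in> gr l" for x y z i j l
    using that by metis
  then show "dOmega gr br f \<in> Omega2 s gr"
    unfolding Omega2_def dOmega_def mem_Collect_eq
    using dCH_in_C10[OF D, unfolded C10_def mem_Collect_eq, simplified] by blast
qed

text \<open>
  All conditions on \<open>D\<close> are linear in the pair \<open>(D, e)\<close>.
\<close>

lemma pencil_combine:
  assumes "D \<in> pencil a" "D' \<in> pencil b"
  shows "(\<lambda>x. s q (D x) + s r (D' x)) \<in> pencil (q * a + r * b)"
proof -
  let ?F = "\<lambda>x. s q (D x) + s r (D' x)"
  have D: "D \<in> graded_maps s gr (-1)" "D' \<in> graded_maps s gr (-1)"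
    using assms by (simp_all add: pencil_def)
  then have F: "?F \<in> graded_maps s gr (-1)"
    by (simp add: graded_maps_iff scale_right_distrib mult.commute gr_add gr_scale)
  have "bv_rule (q * a + r * b) ?F x i y" if "x \<in> gr i" "y \<in> gr j" for x y i j
  proof -
    have "bv_rule a D x i y" "bv_rule b D' x i y" using assms that unfolding pencil_def by blast+
    then show ?thesis
      by (simp add: bv_rule_def distrib_left distrib_right scale_right_distrib scale_left_distrib ksgn_add)
  qed
  moreover have "dCH gr br (-1) ?F x y = 0" if "x \<in> gr i" for x y i
  proof -
    have lin: "D (u + v) = D u + D v" "D' (u + v) = D' u + D' v" for u v
      using D by (auto simp: graded_maps_iff)
    have "dCH gr br (-1) ?F x y = s q (dCH gr br (-1) D x y) + s r (dCH gr br (-1) D' x y)"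
      unfolding dCH_homogeneous[OF F that] dCH_homogeneous[OF D(1) that] dCH_homogeneous[OF D(2) that]
      by (simp add: br_add scale_right_distrib scale_right_diff_distrib ksgn_add)
    then show ?thesis using assms by (simp add: pencil_def)
  qed
  ultimately show ?thesis
    using F bilinear_eq_zero_iff[OF dCH_bilinear[OF F]] by (simp add: pencil_def)
qed

lemma zero_in_pencil: "0 \<in> pencil 0"
proof -
  have "0 \<in> graded_maps s gr (-1)" by (simp add: graded_maps_iff)
  moreover have "dCH gr br (-1) 0 = 0" by (simp add: dCH_def fun_eq_iff)
  ultimately show ?thesis by (simp add: pencil_def bv_rule_def)
qed

lemma pencil_torsor: "additive_torsor s (pencil 0) (pencil e)"
  by (rule additive_torsor_pencil[OF vector_space_axioms pencil_combine zero_in_pencil])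

end

section \<open>Linear maps out of the exterior algebra\<close>

definition linear_extension :: "('k::field \<Rightarrow> 'v::ab_group_add \<Rightarrow> 'v) \<Rightarrow> ('w \<Rightarrow> 'v) \<Rightarrow> ('w \<Rightarrow>\<^sub>0 'k) \<Rightarrow> 'v"
  where "linear_extension s h P = (\<Sum>w\<in>Poly_Mapping.keys P. s (Poly_Mapping.lookup P w) (h w))"

lemma lookup_free_scale [simp]: "Poly_Mapping.lookup (free_scale r P) w = r * Poly_Mapping.lookup P w"
  by (simp add: Poly_Mapping.map.rep_eq when_def)

lemma module_free_scale: "module (free_scale :: 'k::field \<Rightarrow> ('w \<Rightarrow>\<^sub>0 'k) \<Rightarrow> _)"
  by (simp add: module_def poly_mapping_eq_iff fun_eq_iff lookup_add algebra_simps)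

context vector_space
begin

lemma linear_extension_superset:
  assumes "finite F" "Poly_Mapping.keys P \<subseteq> F"
  shows "linear_extension scale h P = (\<Sum>w\<in>F. scale (Poly_Mapping.lookup P w) (h w))"
  unfolding linear_extension_def
  by (rule sum.mono_neutral_left) (use assms in \<open>auto simp: in_keys_iff\<close>)

lemma linear_extension_add:
  "linear_extension scale h (P + Q) = linear_extension scale h P + linear_extension scale h Q"
proof -
  let ?F = "Poly_Mapping.keys P \<union> Poly_Mapping.keys Q"
  have "linear_extension scale h R = (\<Sum>w\<in>?F. scale (Poly_Mapping.lookup R w) (h w))"
    if "Poly_Mapping.keys R \<subseteq> ?F" for R
    by (rule linear_extension_superset) (use that in auto)
  then show ?thesis
    by (simp add: Poly_Mapping.keys_add lookup_add scale_left_distrib sum.distrib)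
qed

lemma linear_extension_scale:
  "linear_extension scale h (free_scale r P) = scale r (linear_extension scale h P)"
proof -
  have "Poly_Mapping.keys (free_scale r P) \<subseteq> Poly_Mapping.keys P"
    by (auto simp: in_keys_iff)
  then show ?thesis
    by (simp add: linear_extension_superset[of "Poly_Mapping.keys P"] scale_sum_right)
qed

lemma linear_extension_single [simp]:
  "linear_extension scale h (Poly_Mapping.single w r) = scale r (h w)"
  by (cases "r = 0") (simp_all add: linear_extension_def)

lemma linear_extension_diff:
  "linear_extension scale h (P - Q) = linear_extension scale h P - linear_extension scale h Q"
  by (rule additive_facts) (rule linear_extension_add)

lemma linear_extension_zero: "linear_extension scale h 0 = 0"
  by (simp add: linear_extension_def)

text \<open>
  The five hypotheses match the five families of generating relations, so this is the universal
  property of the presentation, for maps that are linear over the ground field only.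
\<close>

lemma linear_extension_relations:
  assumes add: "\<And>a b ts. h (a + b, ts) = h (a, ts) + h (b, ts)"
    and scale: "\<And>r a ts. h (sA r a, ts) = scale r (h (a, ts))"
    and add_T: "\<And>a us t t' vs. h (a, us @ (t + t') # vs) = h (a, us @ t # vs) + h (a, us @ t' # vs)"
    and scale_T: "\<And>a b us t vs. h (a, us @ sT b t # vs) = h (a * b, us @ t # vs)"
    and square: "\<And>a us t vs. h (a, us @ t # t # vs) = 0"
    and P: "P \<in> ext_relations sA sT"
  shows "linear_extension scale h P = 0"
proof -
  interpret F: module "free_scale :: 'a \<Rightarrow> _"
    by (rule module_free_scale)
  have "F.subspace {P. linear_extension scale h P = 0}"
    by (simp add: F.subspace_def linear_extension_add linear_extension_scale linear_extension_zero)
  moreover have "ext_generators sA sT \<subseteq> {P. linear_extension scale h P = 0}"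
    unfolding ext_generators_def
    by (auto simp: linear_extension_diff linear_extension_scale add scale add_T scale_T square)
  ultimately have "ext_relations sA sT \<subseteq> {P. linear_extension scale h P = 0}"
    unfolding ext_relations_def by (rule F.span_minimal[rotated])
  then show ?thesis using P by blast
qed

end

context exterior_algebra
begin

lemma free_value_eq: "free_value sG iA iT = linear_extension sG (word_value iA iT)"
  by (simp add: fun_eq_iff free_value_def linear_extension_def)

lemma iA_add: "iA (a + b) = iA a + iA b" and iA_scale: "iA (sA r a) = sG r (iA a)"
  using iA_linear by (auto simp: Vector_Spaces.linear_iff)

lemmas iA_additive = iA_add additive_facts[of iA, OF iA_add]

lemma iA_one_right: "x * iA 1 = x"
  using iA_one iA_central by metis

lemma iA_iA: "iA a * (iA b * x) = iA (a * b) * x"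
  by (simp add: iA_mult mult.assoc)

lemma iT_iA: "iT t * (iA a * x) = iA a * (iT t * x)"
  using iA_central by (metis mult.assoc)

definition monom :: "'t list \<Rightarrow> 'g"
  where "monom ts = foldr (\<lambda>t x. iT t * x) ts (iA 1)"

lemma monom_simps [simp]: "monom [] = iA 1" "monom (t # ts) = iT t * monom ts"
  by (simp_all add: monom_def)

lemma word_value_eq: "word_value iA iT (a, ts) = iA a * monom ts"
proof -
  have "foldl (\<lambda>x t. x * iT t) x ts = x * monom ts" for x
    by (induction ts arbitrary: x) (simp_all add: iA_one_right mult.assoc)
  then show ?thesis by (simp add: word_value_def)
qed

lemma monom_add: "monom (us @ (t + t') # vs) = monom (us @ t # vs) + monom (us @ t' # vs)"
  by (induction us) (simp_all add: iT_add algebra_simps)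

lemma monom_scale: "monom (us @ sT a t # vs) = iA a * monom (us @ t # vs)"
  by (induction us) (simp_all add: iT_scale mult.assoc iT_iA)

text \<open>
  The relations might identify elements of \<open>A\<close>. They do not: the projection of the free space to words of length
  zero respects all relations (those between longer words go to \<open>0\<close>) and recovers \<open>a\<close> from \<open>iA a\<close>.
\<close>

lemma iA_inj: "inj iA"
proof -
  interpret A: vector_space sA
    using iA_linear by (simp add: Vector_Spaces.linear_iff)
  have "a = 0" if "iA a = 0" for a
  proof -
    have "free_value sG iA iT (word_of a []) = 0"
      using that by (simp add: free_value_eq word_value_eq)
    then have "word_of a [] \<in> ext_relations sA sT"
      using presented by blast
    then have "linear_extension sA (\<lambda>(a, ts :: 't list). if ts = [] then a else 0) (word_of a [] :: _ \<Rightarrow>\<^sub>0 'k) = 0"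
      by (rule A.linear_extension_relations[rotated -1]) auto
    then show ?thesis by simp
  qed
  then show ?thesis
    by (metis iA_additive(4) eq_iff_diff_eq_0 injI)
qed

lemma gr_eq_span: "gr i = G.span {iA a * monom ts | a ts. int (length ts) = i}"
proof -
  have "{word_value iA iT w | w. int (length (snd w)) = i} = {iA a * monom ts | a ts. int (length ts) = i}"
    by (auto simp: word_value_eq[symmetric])
  then show ?thesis using gr_words by metis
qed

lemma gr_words_induct [consumes 1, case_names zero word add]:
  assumes "x \<in> gr i" and z: "P 0" and w: "\<And>a ts. int (length ts) = i \<Longrightarrow> P (iA a * monom ts)"
    and a: "\<And>x y. P x \<Longrightarrow> P y \<Longrightarrow> P (x + y)"
  shows "P x"
  using assms(1) unfolding gr_eq_span
proof (induction rule: G.span_induct_alt)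
  case (step r x y)
  then obtain a ts where x: "int (length ts) = i" "x = iA a * monom ts" by blast
  have "sG r x = iA (sA r a) * monom ts"
    using G_mult_bilinear by (simp add: x bilinear_op_def Vector_Spaces.linear_iff iA_scale)
  then show ?case using w[OF x(1)] step a by simp
qed (rule z)

lemma iA_gr: "iA a \<in> gr 0"
  unfolding gr_eq_span by (rule G.span_base) (use iA_one_right monom_simps(1) in force)

lemma word_gr: "iA a * monom ts \<in> gr (int (length ts))"
  unfolding gr_eq_span by (rule G.span_base) blast

lemma monom_gr: "monom ts \<in> gr (int (length ts))"
  using word_gr[of 1 ts] by (simp add: iA_one)

lemma iT_gr: "iT t \<in> gr 1"
  using monom_gr[of "[t]"] by (simp add: iA_one_right)

lemma gr_0: "gr 0 = range iA"
proof
  show "gr 0 \<subseteq> range iA"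
  proof
    fix x assume "x \<in> gr 0"
    then show "x \<in> range iA"
    proof (induction rule: gr_words_induct)
      case zero
      show ?case by (metis iA_additive(2) rangeI)
    next
      case (word a ts)
      then show ?case by (simp add: iA_one_right)
    next
      case (add x y)
      then show ?case by (auto simp: iA_add[symmetric])
    qed
  qed
qed (use iA_gr in blast)

lemma gr_neg_trivial: "i < 0 \<Longrightarrow> x \<in> gr i \<Longrightarrow> x = 0"
  by (erule gr_words_induct) auto

lemma iA_bij: "bij_betw iA UNIV (gr 0)"
  using iA_inj gr_0 by (simp add: bij_betw_def)

text \<open>
  The relations are exactly the kernel of evaluation, so \<open>D\<close> may be computed on any preimage.
\<close>

lemma words_linear_extension:
  assumes add: "\<And>a b ts. h (a + b, ts) = h (a, ts) + h (b, ts)"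
    and scale: "\<And>r a ts. h (sA r a, ts) = sG r (h (a, ts))"
    and add_T: "\<And>a us t t' vs. h (a, us @ (t + t') # vs) = h (a, us @ t # vs) + h (a, us @ t' # vs)"
    and scale_T: "\<And>a b us t vs. h (a, us @ sT b t # vs) = h (a * b, us @ t # vs)"
    and square: "\<And>a us t vs. h (a, us @ t # t # vs) = 0"
  obtains D where "\<And>x y. D (x + y) = D x + D y" "\<And>r x. D (sG r x) = sG r (D x)"
    "\<And>a ts. D (iA a * monom ts) = h (a, ts)"
proof -
  let ?val = "linear_extension sG (word_value iA iT)"
  define D where "D = (\<lambda>x. linear_extension sG h (inv ?val x))"
  have D: "D (?val P) = linear_extension sG h P" for P
  proof -
    let ?Q = "inv ?val (?val P)"
    have "?val ?Q = ?val P"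
      using generated by (simp add: free_value_eq surj_f_inv_f)
    then have "?val (?Q - P) = 0"
      by (simp add: G.linear_extension_diff)
    then have "?Q - P \<in> ext_relations sA sT"
      using presented unfolding free_value_eq by blast
    then have "linear_extension sG h (?Q - P) = 0"
      by (rule G.linear_extension_relations[rotated -1]) (fact assms)+
    then show ?thesis by (simp add: D_def G.linear_extension_diff)
  qed
  have surj: "\<exists>P. x = ?val P" for x
    using generated by (metis free_value_eq surjD)
  show thesis
  proof
    show "D (x + y) = D x + D y" for x y
      using surj[of x] surj[of y] D G.linear_extension_add by metis
    show "D (sG r x) = sG r (D x)" for r x
      using surj[of x] D G.linear_extension_scale by metis
    show "D (iA a * monom ts) = h (a, ts)" for a ts
      using D[of "word_of a ts"] by (simp add: word_value_eq)
  qed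
qed

end

section \<open>The pencil joining closed one-forms of a Lie algebroid to its BV structures\<close>

context lie_algebroid
begin

lemma sA_mult: "sA r a * b = sA r (a * b)" "a * sA r b = sA r (a * b)"
  using A_mult_bilinear by (auto simp: bilinear_op_def Vector_Spaces.linear_iff)

lemma act_add: "act t (a + b) = act t a + act t b" and act_scalar: "act t (sA r a) = sA r (act t a)"
  using act_linear by (auto simp: Vector_Spaces.linear_iff)

lemmas act_additive = act_add additive_facts[of "act t" for t, OF act_add]

lemma act_one: "act t 1 = 0"
  using act_derivation[of t 1 1] by simp

text \<open>
  For \<open>e = 1\<close> these are the BV structures and for \<open>e = 0\<close> the closed one-forms. Linearity over the
  ground field follows from the rule for \<open>c (sT a t)\<close>, because \<open>T\<close> kills scalars.
\<close>

definition pencil_T :: "'k \<Rightarrow> ('t \<Rightarrow> 'a) set"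
  where "pencil_T e = {c. (\<forall>t u. c (t + u) = c t + c u) \<and>
    (\<forall>a t. c (sT a t) = a * c t + sA e (act t a)) \<and>
    (\<forall>t u. c (lb t u) = act t (c u) - act u (c t))}"

lemma vector_space_restrict_scalars: "vector_space (restrict_scalars sA sT)"
  using act_linear_left by (simp add: Vector_Spaces.linear_iff)

lemma pencil_T_linear:
  assumes "c \<in> pencil_T e"
  shows "Vector_Spaces.linear (restrict_scalars sA sT) sA c"
proof -
  have "c (sT (sA r 1) t) = sA r (c t)" for r t
    using assms by (simp add: pencil_T_def act_scalar act_one sA_mult)
  then show ?thesis
    using assms vector_space_restrict_scalars A.vector_space_axioms
    by (simp add: Vector_Spaces.linear_iff pencil_T_def restrict_scalars_def)
qed

lemma BV_eq_pencil_T: "BV sA sT lb act = pencil_T 1"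
  using pencil_T_linear[of _ 1] by (auto simp: BV_def pencil_T_def Vector_Spaces.linear_iff)

lemma Omega1_cl_T_eq_pencil_T: "Omega1_cl_T sT lb act = pencil_T 0"
proof -
  have "module ((*) :: 'a \<Rightarrow> 'a \<Rightarrow> 'a)"
    by unfold_locales (simp_all add: algebra_simps)
  then have "module_hom sT (*) c \<longleftrightarrow>
      (\<forall>t u. c (t + u) = c t + c u) \<and> (\<forall>a t. c (sT a t) = a * c t)" for c
    using T.module_axioms by (auto simp: module_hom_iff)
  then show ?thesis
    by (auto simp: Omega1_cl_T_def pencil_T_def algebra_simps)
qed

lemma pencil_T_combine:
  assumes "c \<in> pencil_T a" "c' \<in> pencil_T b"
  shows "(\<lambda>t. sA q (c t) + sA r (c' t)) \<in> pencil_T (q * a + r * b)"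
  using assms
  by (simp add: pencil_T_def sA_mult act_additive act_scalar distrib_left
      A.scale_right_distrib A.scale_left_distrib A.scale_right_diff_distrib)

lemma pencil_T_torsor: "additive_torsor sA (pencil_T 0) (pencil_T e)"
proof (rule additive_torsor_pencil[OF A.vector_space_axioms pencil_T_combine])
  show "0 \<in> pencil_T 0" by (simp add: pencil_T_def act_additive)
qed

end

section \<open>The operator on the exterior algebra defined by its restriction to the module\<close>

context Schouten_Nijenhuis_algebra
begin

lemma br_A_T: "br (iA a) (iT t) = - iA (act t a)"
  using br_skew[OF iA_gr iT_gr, of a t] by (simp add: br_T_A)

lemma br_A_A: "br (iA a) (iA b) = 0"
  by (rule gr_neg_trivial[of "-1"]) (use gr_br[OF iA_gr iA_gr] in simp_all)

lemma iT_square: "iT t * iT t = 0"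
proof -
  have "iT t * iT t = - (iT t * iT t)"
    using graded_commute[OF iT_gr iT_gr, of t t] by (simp add: ksgn_def)
  then have "sG 2 (iT t * iT t) = 0"
    by (metis G.scale_left_distrib G.scale_one add.right_inverse one_add_one)
  then show ?thesis by simp
qed

lemma monom_square: "monom (us @ t # t # vs) = 0"
  by (induction us) (simp_all add: mult.assoc[symmetric] iT_square)

text \<open>
  The value on the word \<open>t\<^sub>1 \<dots> t\<^sub>n\<close> that is forced on an operator \<open>D\<close> with \<open>D t = - c t\<close> by reading its
  product rule as a recursion that splits off the first letter. For \<open>e = 0\<close> it is minus the
  contraction with \<open>c\<close>.
\<close>

primrec op_word :: "'k \<Rightarrow> ('t \<Rightarrow> 'a) \<Rightarrow> 't list \<Rightarrow> 'g"
  where "op_word e c [] = 0"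
  | "op_word e c (t # ts) =
      - (iA (c t) * monom ts) - iT t * op_word e c ts - sG e (br (iT t) (monom ts))"

lemma op_word_gr: "op_word e c ts \<in> gr (int (length ts) - 1)"
proof (induction ts)
  case (Cons t ts)
  have "iA (c t) * monom ts \<in> gr (int (length ts))" by (rule word_gr)
  moreover have "iT t * op_word e c ts \<in> gr (int (length ts))"
    using gr_mult[OF iT_gr Cons] by simp
  moreover have "br (iT t) (monom ts) \<in> gr (int (length ts))"
    using gr_br[OF iT_gr monom_gr, of t ts] by simp
  ultimately show ?case by (auto intro!: gr_diff gr_neg gr_scale)
qed simp

context
  fixes e :: 'k and c :: "'t \<Rightarrow> 'a"
  assumes c_add: "c (t + u) = c t + c u"
    and c_scale: "c (sT a t) = a * c t + sA e (act t a)"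
begin

lemma op_word_add:
  "op_word e c (us @ (t + t') # vs) = op_word e c (us @ t # vs) + op_word e c (us @ t' # vs)"
  by (induction us)
    (simp_all add: monom_add c_add iA_add iT_add br_add algebra_simps G.scale_right_distrib)

text \<open>
  For two equal leading letters the contributions of \<open>c t\<close> and of \<open>[t, -]\<close> occur twice with opposite
  signs, and what is left contains \<open>t t = 0\<close> or \<open>[t, t] = 0\<close>.
\<close>

lemma op_word_square: "op_word e c (us @ t # t # vs) = 0"
proof (induction us)
  case Nil
  have "br (iT t) (iT t * monom vs) = iT t * br (iT t) (monom vs)"
    using br_Leibniz[OF iT_gr iT_gr monom_gr, of t t vs] additive_facts(1)[of iT, OF iT_add]
    by (simp add: br_T_T lb_alternating)
  moreover have "iT t * (iT t * x) = 0" for x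
    by (simp add: mult.assoc[symmetric] iT_square)
  ultimately show ?case by (simp add: iT_iA right_diff_distrib)
qed (simp add: monom_square)

text \<open>
  A function \<open>b\<close> inside the word may be moved to the front at the price of a bracket with \<open>b\<close>. This is
  the relation that makes the tensor product one over \<open>A\<close>. In the base case the term \<open>e (act t b)\<close> of
  the rule for \<open>c (sT b t)\<close> cancels the bracket of \<open>b\<close> and \<open>t\<close>: it is here that the twist in the
  definition of a BV structure is needed.
\<close>

lemma op_word_scale:
  "op_word e c (us @ sT b t # vs) =
    iA b * op_word e c (us @ t # vs) + sG e (br (iA b) (monom (us @ t # vs)))"
proof (induction us)
  case Nil
  let ?W = "monom vs" and ?n = "int (length vs)"
  have W: "br (iA b) ?W \<in> gr (?n - 1)"
    using gr_br[OF iA_gr monom_gr, of b vs] by simp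
  have 1: "br (iA b * iT t) ?W = iA b * br (iT t) ?W + iT t * br (iA b) ?W"
    using br_Leibniz_left[OF iA_gr iT_gr monom_gr, of b t vs] graded_commute[OF W iT_gr, of t]
    by (simp add: ksgn_def)
  have 2: "br (iA b) (iT t * ?W) = - (iA (act t b) * ?W) - iT t * br (iA b) ?W"
    using br_Leibniz[OF iA_gr iT_gr monom_gr, of b t vs] by (simp add: br_A_T ksgn_def)
  show ?case
    by (simp add: 1 2 c_scale iT_scale iA_add iA_scale iT_iA iA_iA mult.assoc algebra_simps
        G.scale_right_distrib G.scale_right_diff_distrib)
next
  case (Cons u us)
  let ?X = "monom (us @ t # vs)"
  have 1: "br (iT u) (iA b * ?X) = iA (act u b) * ?X + iA b * br (iT u) ?X"
    using br_Leibniz[OF iT_gr iA_gr monom_gr, of u b "us @ t # vs"] by (simp add: br_T_A)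
  have 2: "br (iA b) (iT u * ?X) = - (iA (act u b) * ?X) - iT u * br (iA b) ?X"
    using br_Leibniz[OF iA_gr iT_gr monom_gr, of b u "us @ t # vs"] by (simp add: br_A_T ksgn_def)
  show ?case
    by (simp add: Cons 1 2 monom_scale iT_iA iA_iA algebra_simps
        G.scale_right_distrib G.scale_right_diff_distrib)
qed

lemma br_A_A_word: "br (iA a) (iA b * monom ts) = iA b * br (iA a) (monom ts)"
  using br_Leibniz[OF iA_gr iA_gr monom_gr, of a b ts] by (simp add: br_A_A)

lemma br_AA_word: "br (iA (a * b)) (monom ts) = iA a * br (iA b) (monom ts) + iA b * br (iA a) (monom ts)"
  using br_Leibniz_left[OF iA_gr iA_gr monom_gr, of a b ts]
    iA_central[of b "br (iA a) (monom ts)"] by (simp add: iA_mult)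

text \<open>
  By linearity the second argument may be taken to be a word. The recursion gives the rule when the
  first argument is an element of \<open>A\<close> or \<open>T\<close>, and the rule passes to products in the first argument.
\<close>

lemma bv_rule_word:
  assumes D: "D \<in> graded_maps sG gr (-1)"
    and word: "\<And>a ts. D (iA a * monom ts) = iA a * op_word e c ts + sG e (br (iA a) (monom ts))"
    and x: "x \<in> gr i" and y: "y \<in> gr j"
  shows "bv_rule e D x i y"
proof -
  have add: "D (u + v) = D u + D v" for u v using D by (simp add: graded_maps_iff)
  have zero: "D 0 = 0" by (rule additive_facts) (rule add)
  have sgn: "D (ksgn n u) = ksgn n (D u)" for n u
    using additive_facts(2)[of D, OF add] by (simp add: ksgn_def)
  have deg: "D u \<in> gr (l - 1)" if "u \<in> gr l" for u l using D that by (auto simp: graded_maps_iff)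
  have DA: "D (iA a) = 0" for a
    by (rule gr_neg_trivial[of "-1"]) (use deg[OF iA_gr, of a] in simp_all)
  have DT: "D (iT t) = - iA (c t)" for t
    using word[of 1 "[t]"]
    by (simp add: iA_one iA_one_right br_A_T br_T_A act_one iA_additive(2))
  have right: "bv_rule e D u l v" if v: "v \<in> gr j"
    and words: "\<And>b us. int (length us) = j \<Longrightarrow> bv_rule e D u l (iA b * monom us)" for u l v j
    using v
  proof (induction rule: gr_words_induct)
    case (word a ts)
    then show ?case by (rule words)
  next
    case (add v w)
    then show ?case
      by (simp add: bv_rule_def \<open>\<And>u v. D (u + v) = D u + D v\<close> distrib_left br_add ksgn_add
          G.scale_right_distrib algebra_simps)
  qed (simp add: bv_rule_def zero)
  have A: "bv_rule e D (iA a) 0 v" if "v \<in> gr j" for a v j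
    using that
  proof (rule right)
    fix b us
    have "D (iA a * (iA b * monom us)) = iA (a * b) * op_word e c us + sG e (br (iA (a * b)) (monom us))"
      using word[of "a * b" us] by (simp add: iA_iA)
    then show "bv_rule e D (iA a) 0 (iA b * monom us)"
      by (simp add: bv_rule_def DA word br_A_A_word br_AA_word iA_iA algebra_simps G.scale_right_distrib)
  qed
  have T: "bv_rule e D (iT t) 1 v" if "v \<in> gr j" for t v j
    using that
  proof (rule right)
    fix b us
    have 1: "br (iT t) (iA b * monom us) = iA (act t b) * monom us + iA b * br (iT t) (monom us)"
      using br_Leibniz[OF iT_gr iA_gr monom_gr, of t b us] by (simp add: br_T_A)
    have 2: "br (iA b) (iT t * monom us) = - (iA (act t b) * monom us) - iT t * br (iA b) (monom us)"
      using br_Leibniz[OF iA_gr iT_gr monom_gr, of b t us] by (simp add: br_A_T ksgn_def)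
    have "D (iT t * (iA b * monom us)) = iA b * op_word e c (t # us) + sG e (br (iA b) (monom (t # us)))"
      using word[of b "t # us"] by (simp add: iT_iA)
    then show "bv_rule e D (iT t) 1 (iA b * monom us)"
      by (simp add: bv_rule_def DT word 1 2 iT_iA iA_iA ksgn_def algebra_simps
          G.scale_right_distrib G.scale_right_diff_distrib)
  qed
  have W: "bv_rule e D (monom ts) (int (length ts)) w" if "w \<in> gr n" for ts w n
    using that
  proof (induction ts arbitrary: w n)
    case (Cons t ts)
    have "bv_rule e D (iT t * monom ts) (1 + int (length ts)) w"
      by (rule bv_rule_mult[OF iT_gr _ monom_gr _ Cons.prems]) (rule T Cons.IH; assumption)+
    then show ?case by (simp add: add.commute)
  qed (simp add: A)
  show ?thesis
    using x
  proof (induction rule: gr_words_induct)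
    case (word a ts)
    have "bv_rule e D (iA a * monom ts) (0 + int (length ts)) y"
      by (rule bv_rule_mult[OF iA_gr _ monom_gr _ y]) (rule A W; assumption)+
    with word show ?case by simp
  next
    case (add u v)
    then show ?case
      by (simp add: bv_rule_def \<open>\<And>u v. D (u + v) = D u + D v\<close> br_add ksgn_add
          G.scale_right_distrib algebra_simps)
  qed (simp add: bv_rule_def zero)
qed

text \<open>
  On a word with coefficient \<open>a\<close> the product rule leaves no choice but the function \<open>?h\<close> of the proof,
  since \<open>D a\<close> has degree \<open>-1\<close> and so vanishes.
\<close>

lemma exists_operator:
  obtains D where "D \<in> graded_maps sG gr (-1)" "\<And>t. D (iT t) = - iA (c t)"
    "\<And>i j x y. x \<in> gr i \<Longrightarrow> y \<in> gr j \<Longrightarrow> bv_rule e D x i y"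
proof -
  let ?h = "\<lambda>(a, ts). iA a * op_word e c ts + sG e (br (iA a) (monom ts))"
  obtain D where add: "\<And>x y. D (x + y) = D x + D y" and scale: "\<And>r x. D (sG r x) = sG r (D x)"
    and word_D: "\<And>a ts. D (iA a * monom ts) = ?h (a, ts)"
  proof (rule words_linear_extension[of ?h])
    show "?h (a + b, ts) = ?h (a, ts) + ?h (b, ts)" for a b ts
      by (simp add: iA_add br_add distrib_right G.scale_right_distrib)
    show "?h (sA r a, ts) = sG r (?h (a, ts))" for r a ts
      by (simp add: iA_scale G.scale_right_distrib mult.commute)
    show "?h (a, us @ (t + t') # vs) = ?h (a, us @ t # vs) + ?h (a, us @ t' # vs)" for a us t t' vs
      by (simp add: op_word_add monom_add br_add distrib_left G.scale_right_distrib)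
    show "?h (a, us @ sT b t # vs) = ?h (a * b, us @ t # vs)" for a b us t vs
      by (simp add: op_word_scale monom_scale br_A_A_word br_AA_word iA_iA distrib_left
          G.scale_right_distrib)
    show "?h (a, us @ t # t # vs) = 0" for a us t vs
      by (simp add: op_word_square monom_square)
  qed auto
  have "D x \<in> gr (i + - 1)" if "x \<in> gr i" for x i
    using that
  proof (induction rule: gr_words_induct)
    case (word a ts)
    have "iA a * op_word e c ts \<in> gr (int (length ts) - 1)"
      using gr_mult[OF iA_gr op_word_gr] by simp
    moreover have "br (iA a) (monom ts) \<in> gr (int (length ts) - 1)"
      using gr_br[OF iA_gr monom_gr] by simp
    ultimately show ?case
      using word.hyps word_D by (auto intro!: gr_add gr_scale)
  qed (auto simp: add gr_add additive_facts(1)[of D, OF add])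
  with add scale have D: "D \<in> graded_maps sG gr (-1)" by (simp add: graded_maps_iff)
  show thesis
  proof
    show "D (iT t) = - iA (c t)" for t
      using word_D[of 1 "[t]"]
      by (simp add: iA_one iA_one_right br_A_T br_T_A act_one iA_additive(2))
    show "bv_rule e D x i y" if "x \<in> gr i" "y \<in> gr j" for x y i j
      by (rule bv_rule_word[OF D _ that]) (simp add: word_D)
  qed (rule D)
qed

end

section \<open>Restriction to the module is an isomorphism of torsors\<close>

lemma word_induct:
  assumes w: "\<And>a ts. P (iA a * monom ts)" and a: "\<And>x y. P x \<Longrightarrow> P y \<Longrightarrow> P (x + y)"
  shows "P x"
proof (induction x rule: homogeneous_induct)
  case (homogeneous i x)
  have "P 0" using w[of 0 "[]"] by (simp add: iA_additive(2))
  from homogeneous show ?case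
  proof (induction rule: gr_words_induct)
    case zero
    show ?case by (rule \<open>P 0\<close>)
  qed (rule w a; assumption?)+
qed (rule a)

lemma dCH_T_T:
  assumes "D \<in> graded_maps sG gr (-1)" and "\<And>t. D (iT t) = - iA (c t)"
  shows "dCH gr br (-1) D (iT t) (iT u) = iA (c (lb t u) - (act t (c u) - act u (c t)))"
  unfolding dCH_homogeneous[OF assms(1) iT_gr]
  by (simp add: br_T_T br_T_A br_A_T assms(2) iA_additive)

text \<open>
  As \<open>dCH D\<close> is a derivation in the second argument and skew, it vanishes once it does on pairs of
  generators. Pairs that involve an element of \<open>A\<close> have values in negative degrees, which leaves the
  pairs from \<open>T\<close>; there the condition is the flatness \<open>c [t, u] = t (c u) - u (c t)\<close> of the
  restriction.
\<close>

lemma dCH_eq_zero: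
  assumes D: "D \<in> graded_maps sG gr (-1)"
    and rule: "\<And>i j x y. x \<in> gr i \<Longrightarrow> y \<in> gr j \<Longrightarrow> bv_rule e D x i y"
    and TT: "\<And>t u. dCH gr br (-1) D (iT t) (iT u) = 0"
  shows "dCH gr br (-1) D = 0"
proof -
  let ?B = "dCH gr br (-1) D"
  note lin = dCH_bilinear[OF D, unfolded bilinear_op_iff]
  have Leibniz: "?B x (y * z) = ksgn (j * i) (y * ?B x z) + ?B x y * z"
    if "x \<in> gr i" "y \<in> gr j" "z \<in> gr l" for x y z i j l
    by (rule dCH_Leibniz[OF D rule that])
  have gens: "?B x y = 0" if x: "x \<in> gr i" and A: "\<And>a. ?B x (iA a) = 0" and T: "\<And>t. ?B x (iT t) = 0"
    for x y i
  proof -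
    have m: "?B x (monom ts) = 0" for ts
      by (induction ts) (simp_all add: A T Leibniz[OF x iT_gr monom_gr])
    show ?thesis
      by (induction y rule: word_induct) (use lin in \<open>simp_all add: A m Leibniz[OF x iA_gr monom_gr]\<close>)
  qed
  have neg: "?B x y = 0" if "x \<in> gr i" "y \<in> gr j" "i + j < 2" for x y i j
    by (rule gr_neg_trivial[OF _ dCH_degree[OF D that(1,2)]]) (use that in simp)
  have T: "?B (iT t) y = 0" for t y
    by (rule gens[OF iT_gr]) (simp_all add: TT neg[OF iT_gr iA_gr])
  have A: "?B (iA a) y = 0" for a y
    by (rule gens[OF iA_gr]) (simp_all add: neg[OF iA_gr iA_gr] neg[OF iA_gr iT_gr])
  have "?B x y = 0" if x: "x \<in> gr i" for x y i
    by (rule gens[OF x]) (simp_all add: dCH_skew[OF D x iT_gr] dCH_skew[OF D x iA_gr] T A)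
  then show ?thesis
    using bilinear_eq_zero_iff[OF dCH_bilinear[OF D]] by blast
qed

lemma derivation_eq_zero:
  assumes D: "D \<in> pencil 0" and T: "\<And>t. D (iT t) = 0"
  shows "D = 0"
proof -
  have deg: "D \<in> graded_maps sG gr (-1)" using D by (simp add: pencil_def)
  have add: "D (u + v) = D u + D v" for u v using deg by (simp add: graded_maps_iff)
  have rule: "D (x * y) = D x * y + ksgn i (x * D y)" if "x \<in> gr i" "y \<in> gr j" for x y i j
  proof -
    have "bv_rule 0 D x i y" using D that unfolding pencil_def by blast
    then show ?thesis by (simp add: bv_rule_def)
  qed
  have A: "D (iA a) = 0" for a
  proof (rule gr_neg_trivial[of "-1"])
    have "D (iA a) \<in> gr (0 + - 1)" using deg iA_gr unfolding graded_maps_iff by blast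
    then show "D (iA a) \<in> gr (-1)" by simp
  qed simp
  have m: "D (monom ts) = 0" for ts
    by (induction ts) (simp_all add: A T rule[OF iT_gr monom_gr])
  have "D x = 0" for x
    by (induction x rule: word_induct) (simp_all add: add A m rule[OF iA_gr monom_gr])
  then show ?thesis by (simp add: fun_eq_iff)
qed

lemma neg_restrict_eq_iff:
  assumes D: "D \<in> graded_maps sG gr (-1)"
  shows "neg_restrict iA iT D = c \<longleftrightarrow> (\<forall>t. D (iT t) = - iA (c t))"
proof -
  have "D (iT t) \<in> gr (1 + - 1)" for t
    using D iT_gr unfolding graded_maps_iff by blast
  then have "iA (inv iA (D (iT t))) = D (iT t)" for t
    by (simp add: gr_0 f_inv_into_f)
  then have "neg_restrict iA iT D t = c t \<longleftrightarrow> D (iT t) = - iA (c t)" for t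
    using iA_inj unfolding neg_restrict_def
    by (metis iA_additive(3) injD minus_minus)
  then show ?thesis by (auto simp: fun_eq_iff)
qed

lemma neg_restrict_pencil:
  assumes "D \<in> pencil e"
  shows "neg_restrict iA iT D \<in> pencil_T e"
proof -
  let ?c = "neg_restrict iA iT D"
  have D: "D \<in> graded_maps sG gr (-1)" using assms by (simp add: pencil_def)
  then have c: "D (iT t) = - iA (?c t)" for t
    using neg_restrict_eq_iff by blast
  have add: "D (u + v) = D u + D v" for u v using D by (simp add: graded_maps_iff)
  have eqI: "a = b" if "iA a = iA b" for a b using that iA_inj by (simp add: injD)
  have "iA (?c (t + u)) = iA (?c t + ?c u)" for t u
  proof -
    have "- iA (?c (t + u)) = - iA (?c t) - iA (?c u)"
      unfolding c[symmetric] iT_add add by (simp add: c)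
    then show ?thesis by (simp add: iA_add) (metis add_uminus_conv_diff minus_add_distrib neg_equal_iff_equal)
  qed
  moreover have "iA (?c (sT a t)) = iA (a * ?c t + sA e (act t a))" for a t
  proof -
    have "D (iA a) \<in> gr (0 + - 1)" using D iA_gr unfolding graded_maps_iff by blast
    then have A: "D (iA a) = 0" using gr_neg_trivial[of "-1"] by simp
    have "bv_rule e D (iA a) 0 (iT t)" using assms iA_gr iT_gr unfolding pencil_def by blast
    then have "- iA (?c (sT a t)) = iA a * - iA (?c t) + sG e (- iA (act t a))"
      by (simp add: bv_rule_def A c[symmetric] iT_scale br_A_T)
    then show ?thesis by (simp add: iA_add iA_mult iA_scale) (metis add_uminus_conv_diff minus_add_distrib neg_equal_iff_equal)
  qed
  moreover have "?c (lb t u) = act t (?c u) - act u (?c t)" for t u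
  proof -
    have "iA (?c (lb t u) - (act t (?c u) - act u (?c t))) = iA 0"
      using dCH_T_T[OF D c, of t u] assms by (simp add: pencil_def iA_additive(2))
    then have "?c (lb t u) - (act t (?c u) - act u (?c t)) = 0" by (rule eqI)
    then show ?thesis by simp
  qed
  ultimately show ?thesis
    unfolding pencil_T_def using eqI by blast
qed

lemma neg_restrict_combine:
  assumes "D \<in> graded_maps sG gr (-1)" "D' \<in> graded_maps sG gr (-1)"
  shows "neg_restrict iA iT (\<lambda>x. sG q (D x) + sG r (D' x)) =
    (\<lambda>t. sA q (neg_restrict iA iT D t) + sA r (neg_restrict iA iT D' t))"
proof -
  have "(\<lambda>x. sG q (D x) + sG r (D' x)) \<in> graded_maps sG gr (-1)"
    using assms by (simp add: graded_maps_iff G.scale_right_distrib mult.commute gr_add gr_scale)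
  moreover have "D (iT t) = - iA (neg_restrict iA iT D t)" "D' (iT t) = - iA (neg_restrict iA iT D' t)" for t
    using assms neg_restrict_eq_iff by blast+
  ultimately show ?thesis
    by (simp add: neg_restrict_eq_iff iA_additive iA_scale)
qed

lemma neg_restrict_bij: "bij_betw (neg_restrict iA iT) (pencil e) (pencil_T e)"
  unfolding bij_betw_def
proof
  show "inj_on (neg_restrict iA iT) (pencil e)"
  proof (rule inj_onI)
    fix D D' assume D: "D \<in> pencil e" "D' \<in> pencil e" and eq: "neg_restrict iA iT D = neg_restrict iA iT D'"
    have "D \<in> graded_maps sG gr (-1)" "D' \<in> graded_maps sG gr (-1)"
      using D by (simp_all add: pencil_def)
    then have "D (iT t) = D' (iT t)" for t
      using eq neg_restrict_eq_iff by metis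
    moreover have "D' - D \<in> pencil 0"
    proof -
      have "D' - D = (\<lambda>x. sG (- 1) (D x) + sG 1 (D' x))" by auto
      then show ?thesis using pencil_combine[OF D, of "-1" 1] by simp
    qed
    ultimately have "D' - D = 0" by (intro derivation_eq_zero) simp_all
    then show "D = D'" by simp
  qed
  show "neg_restrict iA iT ` pencil e = pencil_T e"
  proof
    show "pencil_T e \<subseteq> neg_restrict iA iT ` pencil e"
    proof
      fix c assume c: "c \<in> pencil_T e"
      then obtain D where D: "D \<in> graded_maps sG gr (-1)" "\<And>t. D (iT t) = - iA (c t)"
        and rule: "\<And>i j x y. x \<in> gr i \<Longrightarrow> y \<in> gr j \<Longrightarrow> bv_rule e D x i y"
        using exists_operator[of c e] unfolding pencil_T_def by blast
      have "dCH gr br (-1) D (iT t) (iT u) = 0" for t u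
        using dCH_T_T[OF D] c by (simp add: pencil_T_def iA_additive(2))
      then have "dCH gr br (-1) D = 0" using dCH_eq_zero[OF D(1) rule] by simp
      then have "D \<in> pencil e" using D(1) rule unfolding pencil_def by blast
      then show "c \<in> neg_restrict iA iT ` pencil e"
        using neg_restrict_eq_iff[OF D(1), of c] D(2) by (metis imageI)
    qed
  qed (use neg_restrict_pencil in blast)
qed

lemma neg_restrict_torsor_iso:
  "torsor_iso sG (pencil 0) (pencil e) sA (pencil_T 0) (pencil_T e) (neg_restrict iA iT) (neg_restrict iA iT)"
proof -
  have g: "D \<in> graded_maps sG gr (-1)" if "D \<in> pencil e" for D e
    using that by (simp add: pencil_def)
  have "neg_restrict iA iT (D + D') = neg_restrict iA iT D + neg_restrict iA iT D'"
    if "D \<in> pencil a" "D' \<in> pencil b" for D D' a b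
    using neg_restrict_combine[OF g g, OF that, of 1 1] by (simp add: plus_fun_def)
  moreover have "neg_restrict iA iT (pointwise sG r D) = pointwise sA r (neg_restrict iA iT D)"
    if "D \<in> pencil a" for D a r
    using neg_restrict_combine[OF g g, OF that that, of r 0] by (simp add: pointwise_def)
  ultimately show ?thesis
    unfolding torsor_iso_def using neg_restrict_bij by blast
qed

end

theorem mainTheorem1:
  fixes sG :: "'k::field_char_0 \<Rightarrow> 'g::ring \<Rightarrow> 'g"
    and gr :: "int \<Rightarrow> 'g set"
    and br :: "'g \<Rightarrow> 'g \<Rightarrow> 'g"
    and sA :: "'k \<Rightarrow> 'a::comm_ring_1 \<Rightarrow> 'a"
    and sT :: "'a \<Rightarrow> 't::ab_group_add \<Rightarrow> 't"
    and lb :: "'t \<Rightarrow> 't \<Rightarrow> 't"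
    and act :: "'t \<Rightarrow> 'a \<Rightarrow> 'a"
    and iA :: "'a \<Rightarrow> 'g"
    and iT :: "'t \<Rightarrow> 'g"
  shows "(Gerstenhaber_algebra sG gr br \<longrightarrow>
        dTot gr br (-1) \<in> Tot0 sG gr (-1) \<rightarrow> Tot1 sG gr (-1)
      \<and> dOmega gr br \<in> Omega1 sG gr \<rightarrow> Omega2 sG gr
      \<and> H0_Tot sG gr br (-1) = ker_dH sG gr (-1) \<inter> ker_dCH sG gr br (-1)
      \<and> ker_dH sG gr (-1) \<inter> ker_dCH sG gr br (-1) = Omega1_cl sG gr br
      \<and> additive_torsor sG (H0_Tot sG gr br (-1)) (qBV sG gr br))
    \<and> (Schouten_Nijenhuis_algebra sA sT lb act sG gr iA iT br \<longrightarrow>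
        bij_betw iA UNIV (gr 0)
      \<and> additive_torsor sG (Omega1_cl sG gr br) (qBV sG gr br)
      \<and> additive_torsor sA (Omega1_cl_T sT lb act) (BV sA sT lb act)
      \<and> torsor_iso sG (Omega1_cl sG gr br) (qBV sG gr br)
          sA (Omega1_cl_T sT lb act) (BV sA sT lb act)
          (neg_restrict iA iT) (neg_restrict iA iT))"
proof (intro conjI impI)
  assume "Gerstenhaber_algebra sG gr br"
  then interpret Gerstenhaber_algebra sG gr br .
  show "dTot gr br (-1) \<in> Tot0 sG gr (-1) \<rightarrow> Tot1 sG gr (-1)" by (rule dTot_maps)
  show "dOmega gr br \<in> Omega1 sG gr \<rightarrow> Omega2 sG gr" by (rule dOmega_maps)
  show "H0_Tot sG gr br (-1) = ker_dH sG gr (-1) \<inter> ker_dCH sG gr br (-1)"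
    by (rule H0_Tot_eq_kernels)
  show "ker_dH sG gr (-1) \<inter> ker_dCH sG gr br (-1) = Omega1_cl sG gr br"
    by (rule kernels_eq_Omega1_cl)
  show "additive_torsor sG (H0_Tot sG gr br (-1)) (qBV sG gr br)"
    unfolding H0_Tot_eq_kernels kernels_eq_Omega1_cl Omega1_cl_eq_pencil qBV_eq_pencil
    by (rule pencil_torsor)
next
  assume "Schouten_Nijenhuis_algebra sA sT lb act sG gr iA iT br"
  then interpret Schouten_Nijenhuis_algebra sA sT lb act sG gr iA iT br .
  show "bij_betw iA UNIV (gr 0)" by (rule iA_bij)
  show "additive_torsor sG (Omega1_cl sG gr br) (qBV sG gr br)"
    unfolding Omega1_cl_eq_pencil qBV_eq_pencil by (rule pencil_torsor)
  show "additive_torsor sA (Omega1_cl_T sT lb act) (BV sA sT lb act)"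
    unfolding Omega1_cl_T_eq_pencil_T BV_eq_pencil_T by (rule pencil_T_torsor)
  show "torsor_iso sG (Omega1_cl sG gr br) (qBV sG gr br)
      sA (Omega1_cl_T sT lb act) (BV sA sT lb act) (neg_restrict iA iT) (neg_restrict iA iT)"
    unfolding Omega1_cl_eq_pencil qBV_eq_pencil Omega1_cl_T_eq_pencil_T BV_eq_pencil_T
    by (rule neg_restrict_torsor_iso)
qed

end
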